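(* Let $\Gamma=(V,E,s,r)$ be a row-finite directed graph and let $S$ be a commutative semiring. Then the Leavitt path algebra $L_S(\Gamma)$ is congruence-simple if and only if the following three conditions are satisfied: (1) $S$ is either a field or the Boolean semifield $\mathbf{B}$; (2) the only hereditary and saturated subsets of $V$ are $\varnothing$ and $V$; (3) every cycle in $\Gamma$ has an exit.
   Context: Semirings. A hemiring $(R,+,\cdot,0)$ is an algebra such that $(R,+,0)$ is a commutative monoid, $(R,\cdot)$ is a semigroup, multiplication distributes over addition from either side, and $0x=0=x0$ for all $x\in R$. A semiring is a hemiring with a multiplicative identity $1$; it is commutative if its multiplication is. The Boolean semifield $\mathbf{B}=\{0,1\}$ is the two-element semiring with $1+1=1$. A congruence on a hemiring $R$ is an equivalence relation $\rho$ on $R$ such that $(x+a,x+b),(xa,xb),(ax,bx)\in\rho$ for all $(a,b)\in\rho$, $x\in R$. A hemiring $R$ is congruence-simple if the diagonal $\{(x,x)\mid x\in R\}$ and $R^2$ are the only congruences on $R$. For a commutative semiring $S$, an $S$-semimodule is a commutative monoid $(M,+,0)$ with a scalar multiplication $S\times M\to M$ satisfying $(st)m=s(tm)$, $s(m+m')=sm+sm'$, $(s+t)m=sm+tm$, $1m=m$, $s0=0=0m$; an $S$-algebra is an $S$-semimodule with an associative $S$-bilinear multiplication (not necessarily unital). Graphs. A directed graph $\Gamma=(V,E,s,r)$ consists of disjoint sets $V$ (vertices) and $E$ (edges) and maps $s,r:E\to V$ (source, range). It is row-finite if $|s^{-1}(v)|<\infty$ for every $v\in V$. A vertex $v$ is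 regular if $0<|s^{-1}(v)|<\infty$. A path is a sequence of edges $p=e_1\dots e_n$ with $r(e_i)=s(e_{i+1})$ for $1\le i\le n-1$; put $s(p)=s(e_1)$, $r(p)=r(e_n)$; vertices are paths of length $0$. A cycle is given by a path $e_1\dots e_n$ ($n\ge 1$) with $s(e_1)=r(e_n)$ and $s(e_1),\dots,s(e_n)$ pairwise distinct. An exit for a path $e_1\dots e_n$ is an edge $f$ with $s(f)=s(e_i)$ and $f\ne e_i$ for some $1\le i\le n$. A subset $H\subseteq V$ is hereditary if $s(e)\in H$ implies $r(e)\in H$ for all $e\in E$, and saturated if $v\in H$ for every regular vertex $v$ with $r(s^{-1}(v))\subseteq H$. Leavitt path algebra. $L_S(\Gamma)$ is the $S$-algebra presented by generators $V\cup E\cup E^*$, where $E\to E^*$, $e\mapsto e^*$, is a bijection and $V,E,E^*$ are pairwise disjoint, and relations: (1) $vv'=\delta_{v,v'}v$ for $v,v'\in V$; (2) $s(e)e=e=e\,r(e)$ and $r(e)e^*=e^*=e^*s(e)$ for $e\in E$; (3) $e^*f=\delta_{e,f}r(e)$ for $e,f\in E$; (4) $v=\sum_{e\in s^{-1}(v)}ee^*$ for every regular vertex $v$.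
   Formalization: The graph is assumed to have at least one vertex and the semiring S to satisfy 0 ≠ 1; otherwise the Leavitt path algebra is zero, hence congruence-simple, although S need not be a field or the Boolean semifield. *)

theory Defs
  imports "Graph_Theory.Arc_Walk" "HOL-Library.Poly_Mapping"
begin

section \<open>Hemirings and congruence-simpleness\<close>

text \<open>
  HOL-Algebra's \<open>ring\<close> record and \<open>semiring\<close> locale presuppose a multiplicative identity, which a
  Leavitt path algebra of a graph with infinitely many vertices does not have.  Hence the
  following non-unital record.
\<close>

record 'a hemiring =
  hcarrier :: "'a set"
  hplus :: "'a \<Rightarrow> 'a \<Rightarrow> 'a"
  hmult :: "'a \<Rightarrow> 'a \<Rightarrow> 'a"
  hzero :: "'a"

record ('s, 'a) semialgebra = "'a hemiring" +
  hscale :: "'s \<Rightarrow> 'a \<Rightarrow> 'a"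

locale hemiring =
  fixes R :: "('a, 'm) hemiring_scheme"
  assumes zero_closed: "hzero R \<in> hcarrier R"
    and plus_closed: "\<lbrakk>x \<in> hcarrier R; y \<in> hcarrier R\<rbrakk> \<Longrightarrow> hplus R x y \<in> hcarrier R"
    and mult_closed: "\<lbrakk>x \<in> hcarrier R; y \<in> hcarrier R\<rbrakk> \<Longrightarrow> hmult R x y \<in> hcarrier R"
    and plus_assoc: "\<lbrakk>x \<in> hcarrier R; y \<in> hcarrier R; z \<in> hcarrier R\<rbrakk>
      \<Longrightarrow> hplus R (hplus R x y) z = hplus R x (hplus R y z)"
    and plus_commute: "\<lbrakk>x \<in> hcarrier R; y \<in> hcarrier R\<rbrakk> \<Longrightarrow> hplus R x y = hplus R y x"
    and zero_plus: "x \<in> hcarrier R \<Longrightarrow> hplus R (hzero R) x = x"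
    and mult_assoc: "\<lbrakk>x \<in> hcarrier R; y \<in> hcarrier R; z \<in> hcarrier R\<rbrakk>
      \<Longrightarrow> hmult R (hmult R x y) z = hmult R x (hmult R y z)"
    and plus_mult: "\<lbrakk>x \<in> hcarrier R; y \<in> hcarrier R; z \<in> hcarrier R\<rbrakk>
      \<Longrightarrow> hmult R (hplus R x y) z = hplus R (hmult R x z) (hmult R y z)"
    and mult_plus: "\<lbrakk>x \<in> hcarrier R; y \<in> hcarrier R; z \<in> hcarrier R\<rbrakk>
      \<Longrightarrow> hmult R x (hplus R y z) = hplus R (hmult R x y) (hmult R x z)"
    and zero_mult: "x \<in> hcarrier R \<Longrightarrow> hmult R (hzero R) x = hzero R"
    and mult_zero: "x \<in> hcarrier R \<Longrightarrow> hmult R x (hzero R) = hzero R"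

locale semialgebra = hemiring A
  for A :: "('s::comm_semiring_1, 'a, 'm) semialgebra_scheme" +
  assumes scale_closed: "x \<in> hcarrier A \<Longrightarrow> hscale A c x \<in> hcarrier A"
    and scale_scale: "x \<in> hcarrier A \<Longrightarrow> hscale A (c * d) x = hscale A c (hscale A d x)"
    and scale_plus: "\<lbrakk>x \<in> hcarrier A; y \<in> hcarrier A\<rbrakk>
      \<Longrightarrow> hscale A c (hplus A x y) = hplus A (hscale A c x) (hscale A c y)"
    and plus_scale: "x \<in> hcarrier A
      \<Longrightarrow> hscale A (c + d) x = hplus A (hscale A c x) (hscale A d x)"
    and one_scale: "x \<in> hcarrier A \<Longrightarrow> hscale A 1 x = x"
    and scale_zero: "hscale A c (hzero A) = hzero A"
    and zero_scale: "x \<in> hcarrier A \<Longrightarrow> hscale A 0 x = hzero A"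
    and scale_mult_left: "\<lbrakk>x \<in> hcarrier A; y \<in> hcarrier A\<rbrakk>
      \<Longrightarrow> hmult A (hscale A c x) y = hscale A c (hmult A x y)"
    and scale_mult_right: "\<lbrakk>x \<in> hcarrier A; y \<in> hcarrier A\<rbrakk>
      \<Longrightarrow> hmult A x (hscale A c y) = hscale A c (hmult A x y)"

definition hemiring_congruence :: "('a, 'm) hemiring_scheme \<Rightarrow> ('a \<times> 'a) set \<Rightarrow> bool" where
  "hemiring_congruence R \<rho> \<longleftrightarrow>
     equiv (hcarrier R) \<rho> \<and>
     (\<forall>x \<in> hcarrier R. \<forall>(a, b) \<in> \<rho>.
        (hplus R x a, hplus R x b) \<in> \<rho> \<and>
        (hmult R x a, hmult R x b) \<in> \<rho> \<and>
        (hmult R a x, hmult R b x) \<in> \<rho>)"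

definition congruence_simple :: "('a, 'm) hemiring_scheme \<Rightarrow> bool" where
  "congruence_simple R \<longleftrightarrow>
     (\<forall>\<rho>. hemiring_congruence R \<rho> \<longrightarrow> \<rho> = Id_on (hcarrier R) \<or> \<rho> = hcarrier R \<times> hcarrier R)"


section \<open>Conditions on the coefficient semiring\<close>

text \<open>
  The coefficient semiring is a type of class \<open>comm_semiring_1\<close>; in particular \<open>0 \<noteq> 1\<close>.
\<close>

definition is_field_semiring :: "'s::comm_semiring_1 itself \<Rightarrow> bool" where
  "is_field_semiring _ \<longleftrightarrow>
     (\<forall>a::'s. \<exists>b. a + b = 0) \<and> (\<forall>a::'s. a \<noteq> 0 \<longrightarrow> (\<exists>b. a * b = 1))"

definition is_boolean_semifield :: "'s::comm_semiring_1 itself \<Rightarrow> bool" where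
  "is_boolean_semifield _ \<longleftrightarrow> (UNIV :: 's set) = {0, 1} \<and> (1::'s) + 1 = 1"


section \<open>Graphs\<close>

text \<open>
  A directed graph \<open>(V, E, s, r)\<close> is a \<^locale>\<open>wf_digraph\<close> with \<open>V = verts G\<close>, \<open>E = arcs G\<close>,
  \<open>s = tail G\<close>, \<open>r = head G\<close>; so \<open>s\<inverse>(v)\<close> is \<^term>\<open>out_arcs G v\<close>.
\<close>

definition row_finite :: "('v, 'e) pre_digraph \<Rightarrow> bool" where
  "row_finite G \<longleftrightarrow> (\<forall>v \<in> verts G. finite (out_arcs G v))"

definition regular_vertex :: "('v, 'e) pre_digraph \<Rightarrow> 'v \<Rightarrow> bool" where
  "regular_vertex G v \<longleftrightarrow> v \<in> verts G \<and> out_arcs G v \<noteq> {} \<and> finite (out_arcs G v)"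

definition hereditary :: "('v, 'e) pre_digraph \<Rightarrow> 'v set \<Rightarrow> bool" where
  "hereditary G H \<longleftrightarrow> (\<forall>e \<in> arcs G. tail G e \<in> H \<longrightarrow> head G e \<in> H)"

definition saturated :: "('v, 'e) pre_digraph \<Rightarrow> 'v set \<Rightarrow> bool" where
  "saturated G H \<longleftrightarrow> (\<forall>v. regular_vertex G v \<and> head G ` out_arcs G v \<subseteq> H \<longrightarrow> v \<in> H)"

definition is_exit :: "('v, 'e) pre_digraph \<Rightarrow> 'e \<Rightarrow> 'e list \<Rightarrow> bool" where
  "is_exit G f p \<longleftrightarrow> f \<in> arcs G \<and> (\<exists>i < length p. tail G f = tail G (p ! i) \<and> f \<noteq> p ! i)"

text \<open>
  The library's \<^const>\<open>pre_digraph.cycle\<close> requires the ranges of the arcs to be distinct; for a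
  closed path this is the same as requiring their sources to be distinct.
\<close>

lemma cycle_iff_distinct_sources:
  "pre_digraph.cycle G p \<longleftrightarrow>
     p \<noteq> [] \<and> (\<exists>u. pre_digraph.awalk G u p u) \<and> distinct (map (tail G) p)"
proof -
  have verts: "pre_digraph.awalk_verts G u p = map (tail G) p @ [v]"
    if "pre_digraph.cas G u p v" for u v p
    using that
    by (induction p arbitrary: u) (auto simp: pre_digraph.awalk_verts.simps pre_digraph.cas.simps)
  have "distinct (tl (pre_digraph.awalk_verts G u p)) \<longleftrightarrow> distinct (map (tail G) p)"
    if "pre_digraph.awalk G u p u" "p \<noteq> []" for u
  proof -
    from that have c: "pre_digraph.cas G u p u" by (simp add: pre_digraph.awalk_def)
    with that obtain e es where "p = e # es" "tail G e = u"
      by (cases p) (auto simp: pre_digraph.cas.simps)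
    with verts[OF c] show ?thesis by auto
  qed
  then show ?thesis unfolding pre_digraph.cycle_def by blast
qed


section \<open>Algebras presented by generators and relations\<close>

text \<open>
  The free monoid on \<open>'g\<close>, written additively because \<^typ>\<open>'a \<Rightarrow>\<^sub>0 'b\<close> provides the monoid
  algebra (with convolution product) over additively written monoids.
\<close>

datatype 'g free_word = Free_Word (letters: "'g list")

instantiation free_word :: (type) monoid_add
begin

definition zero_free_word :: "'a free_word" where
  "0 = Free_Word []"

definition plus_free_word :: "'a free_word \<Rightarrow> 'a free_word \<Rightarrow> 'a free_word" where
  "u + w = Free_Word (letters u @ letters w)"

instance
  by standard (simp_all add: zero_free_word_def plus_free_word_def)

end

lemma letters_zero [simp]: "letters 0 = []"
  and letters_plus [simp]: "letters (u + w) = letters u @ letters w"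
  by (simp_all add: zero_free_word_def plus_free_word_def)

type_synonym ('s, 'g) free_elem = "'g free_word \<Rightarrow>\<^sub>0 's"

text \<open>
  The free (not necessarily unital) \<open>'s\<close>-algebra on the set \<open>X\<close>: finite \<open>'s\<close>-linear combinations
  of nonempty words in \<open>X\<close>.
\<close>

definition free_algebra :: "'g set \<Rightarrow> ('s::comm_semiring_1, 'g) free_elem set" where
  "free_algebra X = {p. \<forall>w \<in> Poly_Mapping.keys p. letters w \<noteq> [] \<and> set (letters w) \<subseteq> X}"

definition gen :: "'g \<Rightarrow> ('s::comm_semiring_1, 'g) free_elem" where
  "gen x = Poly_Mapping.single (Free_Word [x]) 1"

definition free_scale :: "'s::comm_semiring_1 \<Rightarrow> ('s, 'g) free_elem \<Rightarrow> ('s, 'g) free_elem" where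
  "free_scale c p = Poly_Mapping.map ((*) c) p"

text \<open>The least \<open>'s\<close>-algebra congruence on the free algebra on \<open>X\<close> containing \<open>Rel\<close>.\<close>

inductive_set generated_congruence ::
    "'g set \<Rightarrow> (('s::comm_semiring_1, 'g) free_elem \<times> ('s, 'g) free_elem) set
      \<Rightarrow> (('s, 'g) free_elem \<times> ('s, 'g) free_elem) set"
  for X Rel where
    base: "(p, q) \<in> Rel \<Longrightarrow> p \<in> free_algebra X \<Longrightarrow> q \<in> free_algebra X
      \<Longrightarrow> (p, q) \<in> generated_congruence X Rel"
  | refl: "p \<in> free_algebra X \<Longrightarrow> (p, p) \<in> generated_congruence X Rel"
  | sym: "(p, q) \<in> generated_congruence X Rel \<Longrightarrow> (q, p) \<in> generated_congruence X Rel"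
  | trans: "(p, q) \<in> generated_congruence X Rel \<Longrightarrow> (q, r) \<in> generated_congruence X Rel
      \<Longrightarrow> (p, r) \<in> generated_congruence X Rel"
  | plus: "(p, q) \<in> generated_congruence X Rel \<Longrightarrow> r \<in> free_algebra X
      \<Longrightarrow> (r + p, r + q) \<in> generated_congruence X Rel"
  | mult_left: "(p, q) \<in> generated_congruence X Rel \<Longrightarrow> r \<in> free_algebra X
      \<Longrightarrow> (r * p, r * q) \<in> generated_congruence X Rel"
  | mult_right: "(p, q) \<in> generated_congruence X Rel \<Longrightarrow> r \<in> free_algebra X
      \<Longrightarrow> (p * r, q * r) \<in> generated_congruence X Rel"
  | scale: "(p, q) \<in> generated_congruence X Rel
      \<Longrightarrow> (free_scale c p, free_scale c q) \<in> generated_congruence X Rel"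

definition presented_algebra ::
    "'g set \<Rightarrow> (('s::comm_semiring_1, 'g) free_elem \<times> ('s, 'g) free_elem) set
      \<Rightarrow> ('s, ('s, 'g) free_elem set) semialgebra" where
  "presented_algebra X Rel =
     (let \<theta> = generated_congruence X Rel in
      \<lparr> hcarrier = free_algebra X // \<theta>,
        hplus = (\<lambda>P Q. \<Union>p \<in> P. \<Union>q \<in> Q. \<theta> `` {p + q}),
        hmult = (\<lambda>P Q. \<Union>p \<in> P. \<Union>q \<in> Q. \<theta> `` {p * q}),
        hzero = \<theta> `` {0},
        hscale = (\<lambda>c P. \<Union>p \<in> P. \<theta> `` {free_scale c p}) \<rparr>)"


section \<open>Leavitt path algebras\<close>

datatype ('v, 'e) leavitt_gen = Vertex 'v | Edge 'e | Ghost 'e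

definition leavitt_generators :: "('v, 'e) pre_digraph \<Rightarrow> ('v, 'e) leavitt_gen set" where
  "leavitt_generators G = Vertex ` verts G \<union> Edge ` arcs G \<union> Ghost ` arcs G"

inductive_set leavitt_relations ::
    "('v, 'e) pre_digraph \<Rightarrow> (('s::comm_semiring_1, ('v, 'e) leavitt_gen) free_elem
      \<times> ('s, ('v, 'e) leavitt_gen) free_elem) set"
  for G where
    vertex_vertex: "v \<in> verts G \<Longrightarrow> w \<in> verts G \<Longrightarrow>
      (gen (Vertex v) * gen (Vertex w), if v = w then gen (Vertex v) else 0) \<in> leavitt_relations G"
  | source_edge: "e \<in> arcs G \<Longrightarrow>
      (gen (Vertex (tail G e)) * gen (Edge e), gen (Edge e)) \<in> leavitt_relations G"
  | edge_range: "e \<in> arcs G \<Longrightarrow>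
      (gen (Edge e) * gen (Vertex (head G e)), gen (Edge e)) \<in> leavitt_relations G"
  | range_ghost: "e \<in> arcs G \<Longrightarrow>
      (gen (Vertex (head G e)) * gen (Ghost e), gen (Ghost e)) \<in> leavitt_relations G"
  | ghost_source: "e \<in> arcs G \<Longrightarrow>
      (gen (Ghost e) * gen (Vertex (tail G e)), gen (Ghost e)) \<in> leavitt_relations G"
  | ghost_edge: "e \<in> arcs G \<Longrightarrow> f \<in> arcs G \<Longrightarrow>
      (gen (Ghost e) * gen (Edge f), if e = f then gen (Vertex (head G e)) else 0)
        \<in> leavitt_relations G"
  | regular: "regular_vertex G v \<Longrightarrow>
      (gen (Vertex v), \<Sum>e \<in> out_arcs G v. gen (Edge e) * gen (Ghost e)) \<in> leavitt_relations G"

definition leavitt_path_algebra ::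
    "'s::comm_semiring_1 itself \<Rightarrow> ('v, 'e) pre_digraph
      \<Rightarrow> ('s, ('s, ('v, 'e) leavitt_gen) free_elem set) semialgebra" where
  "leavitt_path_algebra _ G = presented_algebra (leavitt_generators G) (leavitt_relations G)"


subsection \<open>Well-definedness\<close>

lemma free_algebra_zero: "0 \<in> free_algebra X"
  by (simp add: free_algebra_def)

lemma free_algebra_plus: "p \<in> free_algebra X \<Longrightarrow> q \<in> free_algebra X \<Longrightarrow> p + q \<in> free_algebra X"
  using keys_add[of p q] unfolding free_algebra_def by blast

lemma free_algebra_mult:
  assumes "p \<in> free_algebra X" "q \<in> free_algebra X"
  shows "p * q \<in> free_algebra X"
  using keys_mult[of p q] assms unfolding free_algebra_def by fastforce

lemma lookup_free_scale: "Poly_Mapping.lookup (free_scale c p) w = c * Poly_Mapping.lookup p w"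
  by (simp add: free_scale_def map.rep_eq when_def)

lemma free_scale_conv_mult: "free_scale c p = Poly_Mapping.single 0 c * p"
  by (simp add: free_scale_def mult_map_scale_conv_mult)

lemma free_algebra_scale: "p \<in> free_algebra X \<Longrightarrow> free_scale c p \<in> free_algebra X"
  unfolding free_algebra_def by (auto simp: in_keys_iff lookup_free_scale)

lemma free_scale_mult_right:
  fixes p q :: "('s::comm_semiring_1, 'g) free_elem"
  shows "p * free_scale c q = free_scale c (p * q)"
proof -
  have comm: "p * Poly_Mapping.single 0 c = Poly_Mapping.single 0 c * p"
  proof (induction p rule: update_induct)
    case const
    show ?case by simp
  next
    case (update f a b)
    then have "Poly_Mapping.update a b f = Poly_Mapping.single a b + f"
      by (intro poly_mapping_eqI)
        (auto simp: lookup_update lookup_add lookup_single in_keys_iff when_def)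
    with update.IH show ?case
      by (simp add: distrib_left distrib_right mult_single mult.commute)
  qed
  show ?thesis
    unfolding free_scale_conv_mult by (metis comm mult.assoc)
qed

lemma gen_in_free_algebra: "x \<in> X \<Longrightarrow> gen x \<in> free_algebra X"
  by (simp add: gen_def free_algebra_def)

lemma leavitt_relations_in_free_algebra:
  assumes "wf_digraph G" "(p, q) \<in> leavitt_relations G"
  shows "p \<in> free_algebra (leavitt_generators G) \<and> q \<in> free_algebra (leavitt_generators G)"
proof -
  interpret wf_digraph G by fact
  let ?A = "free_algebra (leavitt_generators G) :: ('c, ('a, 'b) leavitt_gen) free_elem set"
  have sum: "finite I \<Longrightarrow> (\<And>i. i \<in> I \<Longrightarrow> h i \<in> ?A) \<Longrightarrow> sum h I \<in> ?A"
    for h :: "'b \<Rightarrow> ('c, ('a, 'b) leavitt_gen) free_elem" and I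
    by (induction I rule: finite_induct) (auto simp: free_algebra_zero free_algebra_plus)
  have gens: "v \<in> verts G \<Longrightarrow> gen (Vertex v) \<in> ?A" "e \<in> arcs G \<Longrightarrow> gen (Edge e) \<in> ?A"
    "e \<in> arcs G \<Longrightarrow> gen (Ghost e) \<in> ?A" for v e
    by (auto intro!: gen_in_free_algebra simp: leavitt_generators_def)
  from assms(2) show ?thesis
    by cases (auto intro!: sum gens free_algebra_mult free_algebra_zero simp: regular_vertex_def)
qed

lemma generated_congruence_subset:
  "(p, q) \<in> generated_congruence X Rel \<Longrightarrow> p \<in> free_algebra X \<and> q \<in> free_algebra X"
  by (induction rule: generated_congruence.induct)
    (auto intro: free_algebra_plus free_algebra_mult free_algebra_scale)

lemma equiv_generated_congruence: "equiv (free_algebra X) (generated_congruence X Rel)"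
  by (rule equivI)
    (auto intro!: refl_onI symI transI intro: generated_congruence.intros
      dest: generated_congruence_subset)

lemma presented_algebra_ops:
  fixes X :: "'g set" and Rel :: "(('s::comm_semiring_1, 'g) free_elem \<times> ('s, 'g) free_elem) set"
  defines "\<theta> \<equiv> generated_congruence X Rel"
  assumes p: "p \<in> free_algebra X" and q: "q \<in> free_algebra X"
  shows "hplus (presented_algebra X Rel) (\<theta> `` {p}) (\<theta> `` {q}) = \<theta> `` {p + q}"
    and "hmult (presented_algebra X Rel) (\<theta> `` {p}) (\<theta> `` {q}) = \<theta> `` {p * q}"
    and "hscale (presented_algebra X Rel) c (\<theta> `` {p}) = \<theta> `` {free_scale c p}"
proof -
  have eq: "equiv (free_algebra X) \<theta>"
    unfolding \<theta>_def by (rule equiv_generated_congruence)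
  have sub: "(a, b) \<in> \<theta> \<Longrightarrow> a \<in> free_algebra X \<and> b \<in> free_algebra X" for a b
    unfolding \<theta>_def by (rule generated_congruence_subset)
  have trans: "(a, b) \<in> \<theta> \<Longrightarrow> (b, c) \<in> \<theta> \<Longrightarrow> (a, c) \<in> \<theta>" for a b c
    unfolding \<theta>_def by (rule generated_congruence.trans)
  have "congruent2 \<theta> \<theta> (\<lambda>p q. \<theta> `` {p + q})"
  proof (rule congruent2I')
    fix a b c d assume h: "(a, b) \<in> \<theta>" "(c, d) \<in> \<theta>"
    have "(a + c, a + d) \<in> \<theta>"
      using h sub unfolding \<theta>_def by (blast intro: generated_congruence.plus)
    moreover have "(d + a, d + b) \<in> \<theta>"
      using h sub unfolding \<theta>_def by (blast intro: generated_congruence.plus)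
    ultimately have "(a + c, b + d) \<in> \<theta>"
      using trans by (metis add.commute)
    then show "\<theta> `` {a + c} = \<theta> `` {b + d}" by (rule equiv_class_eq[OF eq])
  qed
  from UN_equiv_class2[OF eq eq this p q]
  show "hplus (presented_algebra X Rel) (\<theta> `` {p}) (\<theta> `` {q}) = \<theta> `` {p + q}"
    by (simp add: presented_algebra_def Let_def \<theta>_def)
  have "congruent2 \<theta> \<theta> (\<lambda>p q. \<theta> `` {p * q})"
  proof (rule congruent2I')
    fix a b c d assume h: "(a, b) \<in> \<theta>" "(c, d) \<in> \<theta>"
    have "(a * c, a * d) \<in> \<theta>"
      using h sub unfolding \<theta>_def by (blast intro: generated_congruence.mult_left)
    moreover have "(a * d, b * d) \<in> \<theta>"
      using h sub unfolding \<theta>_def by (blast intro: generated_congruence.mult_right)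
    ultimately have "(a * c, b * d) \<in> \<theta>" by (rule trans)
    then show "\<theta> `` {a * c} = \<theta> `` {b * d}" by (rule equiv_class_eq[OF eq])
  qed
  from UN_equiv_class2[OF eq eq this p q]
  show "hmult (presented_algebra X Rel) (\<theta> `` {p}) (\<theta> `` {q}) = \<theta> `` {p * q}"
    by (simp add: presented_algebra_def Let_def \<theta>_def)
  have "(\<lambda>p. \<theta> `` {free_scale c p}) respects \<theta>"
  proof (rule congruentI)
    fix a b assume "(a, b) \<in> \<theta>"
    then have "(free_scale c a, free_scale c b) \<in> \<theta>"
      unfolding \<theta>_def by (rule generated_congruence.scale)
    then show "\<theta> `` {free_scale c a} = \<theta> `` {free_scale c b}" by (rule equiv_class_eq[OF eq])
  qed
  from UN_equiv_class[OF eq this p]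
  show "hscale (presented_algebra X Rel) c (\<theta> `` {p}) = \<theta> `` {free_scale c p}"
    by (simp add: presented_algebra_def Let_def \<theta>_def)
qed

lemma semialgebra_presented_algebra: "semialgebra (presented_algebra X Rel)"
proof -
  let ?\<theta> = "generated_congruence X Rel"
  have carr: "hcarrier (presented_algebra X Rel) = free_algebra X // ?\<theta>"
    and zero: "hzero (presented_algebra X Rel) = ?\<theta> `` {0}"
    by (simp_all add: presented_algebra_def Let_def)
  note closed = free_algebra_zero free_algebra_plus free_algebra_mult free_algebra_scale
  note [simp] = closed carr zero presented_algebra_ops(1,2)
    presented_algebra_ops(3)[OF _ free_algebra_zero]
  have scale: "free_scale (c + d) p = free_scale c p + free_scale d p"
    "free_scale (c * d) p = free_scale c (free_scale d p)"
    "free_scale c (p + q) = free_scale c p + free_scale c q"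
    "free_scale 1 p = p" "free_scale c 0 = 0" "free_scale 0 p = 0"
    "free_scale c p * q = free_scale c (p * q)" for c d and p q :: "('b, 'a) free_elem"
    by (auto intro!: poly_mapping_eqI simp: lookup_free_scale lookup_add algebra_simps)
      (simp add: free_scale_conv_mult mult.assoc flip: lookup_free_scale)
  show ?thesis
    by unfold_locales
      (auto elim!: quotientE intro!: quotientI
        simp: add.assoc add.commute add.left_commute mult.assoc distrib_left distrib_right scale free_scale_mult_right)
qed

lemma semialgebra_leavitt_path_algebra: "semialgebra (leavitt_path_algebra TYPE('s::comm_semiring_1) G)"
  unfolding leavitt_path_algebra_def by (rule semialgebra_presented_algebra)

lemma leavitt_relations_hold:
  fixes G :: "('v, 'e) pre_digraph"
    and p q :: "('s::comm_semiring_1, ('v, 'e) leavitt_gen) free_elem"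
  assumes "wf_digraph G" "(p, q) \<in> leavitt_relations G"
  defines "\<theta> \<equiv> generated_congruence (leavitt_generators G) (leavitt_relations G)"
  shows "\<theta> `` {p} = \<theta> `` {q}"
  unfolding \<theta>_def
  using leavitt_relations_in_free_algebra[OF assms(1,2)] assms(2)
  by (intro equiv_class_eq[OF equiv_generated_congruence] generated_congruence.base) simp_all

end

theory Submission
  imports Defs "HOL-Library.Countable_Set" "HOL-Library.Sublist"
begin

text \<open>
  Write \<open>L\<close> for the Leavitt path algebra, and \<open>q*\<close> for the word of ghost edges that reverses a path
  \<open>q\<close>.

  Sufficiency.  Every element of \<open>L\<close> is a linear combination of elements \<open>p q*\<close>, where \<open>p\<close> and \<open>q\<close>
  are paths with the same range.  Expanding the range by the relation
  \<open>v = \<Sum> e e*\<close> repeatedly, one may assume that all \<open>q\<close> have the same length \<open>n\<close>, or are shorter and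
  end in a sink (\<open>eventually_reducible\<close>).  Two such paths are never proper prefixes of one another, so
  that \<open>q* q'\<close> vanishes unless \<open>q = q'\<close>.  Two distinct elements of \<open>L\<close> therefore have normal forms, for a
  common \<open>n\<close>, with different coefficients \<open>a \<noteq> b\<close> at some \<open>p q*\<close>.  Multiplication by \<open>p*\<close> from
  the left and by \<open>q\<close> from the right leaves \<open>a v\<close> and \<open>b v\<close>, where \<open>v\<close> is the range of \<open>p\<close>, plus
  combinations of nontrivial closed paths at \<open>v\<close> and their ghosts.
  Since cycles have exits, there is a path \<open>z\<close> from \<open>v\<close> that is not an initial segment of \<open>t z\<close> for any
  of these closed paths \<open>t\<close> (\<open>path_avoiding_closed_walks\<close>).  Then \<open>z* t z = 0\<close>, and
  compression by \<open>z\<close> leaves exactly \<open>a u\<close> and \<open>b u\<close> for the range \<open>u\<close> of \<open>z\<close>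
  (\<open>isolate_coefficient\<close>).  No subtraction has been used so far.  A congruence that relates
  two distinct elements hence relates \<open>a u\<close> to \<open>b u\<close> with \<open>a \<noteq> b\<close>, and over a field or the Boolean semifield
  it relates \<open>u\<close> to zero.  The vertices related to zero form a hereditary and saturated set, so all
  vertices are related to zero, and with them all elements.

  Necessity.  Let a set \<open>W\<close> of vertices have a hereditary and saturated complement.  The algebra \<open>L\<close> acts
  on the functions on \<open>W \<times> \<int>\<close>: a vertex \<open>v\<close> restricts to \<open>{v} \<times> \<int>\<close>, and if \<open>d\<close> edges lead from \<open>v\<close>
  into \<open>W\<close>, the \<open>i\<close>-th of them is the partial bijection between the points \<open>(v, m)\<close> with
  \<open>m \<equiv> i\<close> modulo \<open>d\<close> and all points \<open>(r(e), (m - i) / d - \<delta>)\<close>, for a fixed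
  integer \<open>\<delta>\<close> (\<open>branching_satisfies_leavitt_relations\<close>).  Every such action, combined with a congruence
  \<open>\<sigma>\<close> of the coefficients, yields a congruence of \<open>L\<close>: relate elements whose actions agree modulo \<open>\<sigma>\<close>.
  If \<open>L\<close> is congruence-simple and this congruence is not total, it is the identity
  (\<open>presented_algebra_cong_if_acts_agree\<close>), so that agreement under one action implies
  agreement under all others.  Each condition follows by a choice of \<open>W\<close>, \<open>\<delta>\<close> and \<open>\<sigma>\<close>: a congruence
  \<open>\<sigma>\<close> that is neither the identity nor total would identify distinct multiples of a vertex, so
  that the semiring of coefficients is congruence-simple and \<open>congruence_simple_comm_semiring_cases\<close> applies; for \<open>W\<close> the complement of a
  hereditary and saturated set \<open>H\<close>, the vertices in \<open>H\<close> act as zero; and a cycle without exit acts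
  like its base vertex for \<open>\<delta> = 0\<close>, but as a proper translation for \<open>\<delta> = 1\<close>.
\<close>

section \<open>Congruence-simple commutative semirings\<close>

definition semiring_congruence :: "('s::comm_semiring_1 \<times> 's) set \<Rightarrow> bool" where
  "semiring_congruence \<sigma> \<longleftrightarrow>
     equiv UNIV \<sigma> \<and> (\<forall>x. \<forall>(a, b) \<in> \<sigma>. (x + a, x + b) \<in> \<sigma> \<and> (x * a, x * b) \<in> \<sigma>)"

lemma semiring_congruenceI:
  assumes "\<And>x. (x, x) \<in> \<sigma>" "\<And>x y. (x, y) \<in> \<sigma> \<Longrightarrow> (y, x) \<in> \<sigma>"
    and "\<And>x y z. (x, y) \<in> \<sigma> \<Longrightarrow> (y, z) \<in> \<sigma> \<Longrightarrow> (x, z) \<in> \<sigma>"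
    and "\<And>x a b. (a, b) \<in> \<sigma> \<Longrightarrow> (x + a, x + b) \<in> \<sigma>"
    and "\<And>x a b. (a, b) \<in> \<sigma> \<Longrightarrow> (x * a, x * b) \<in> \<sigma>"
  shows "semiring_congruence \<sigma>"
proof -
  have "equiv UNIV \<sigma>"
    by (intro equivI refl_onI symI transI)
      (simp, rule assms(1), erule assms(2), erule (1) assms(3))
  with assms(4,5) show ?thesis unfolding semiring_congruence_def by blast
qed

lemma semiring_congruenceD:
  assumes "semiring_congruence \<sigma>"
  shows "(x, x) \<in> \<sigma>" "(x, y) \<in> \<sigma> \<Longrightarrow> (y, x) \<in> \<sigma>"
    and "(x, y) \<in> \<sigma> \<Longrightarrow> (y, z) \<in> \<sigma> \<Longrightarrow> (x, z) \<in> \<sigma>"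
    and "(x, y) \<in> \<sigma> \<Longrightarrow> (a, b) \<in> \<sigma> \<Longrightarrow> (x + a, y + b) \<in> \<sigma>"
    and "(a, b) \<in> \<sigma> \<Longrightarrow> (x * a, x * b) \<in> \<sigma>"
proof -
  from assms have eq: "equiv UNIV \<sigma>" and plus: "\<And>x a b. (a, b) \<in> \<sigma> \<Longrightarrow> (x + a, x + b) \<in> \<sigma>"
    and mult: "\<And>x a b. (a, b) \<in> \<sigma> \<Longrightarrow> (x * a, x * b) \<in> \<sigma>"
    unfolding semiring_congruence_def by auto
  show "(x, x) \<in> \<sigma>" using eq by (auto simp: equiv_def refl_on_def)
  show "(x, y) \<in> \<sigma> \<Longrightarrow> (y, x) \<in> \<sigma>" using eq by (auto simp: equiv_def sym_def)
  show tr: "(x, y) \<in> \<sigma> \<Longrightarrow> (y, z) \<in> \<sigma> \<Longrightarrow> (x, z) \<in> \<sigma>" for x y z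
    using eq by (meson equiv_def transD)
  show "(x, y) \<in> \<sigma> \<Longrightarrow> (a, b) \<in> \<sigma> \<Longrightarrow> (x + a, y + b) \<in> \<sigma>"
    using tr[of "x + a" "x + b" "y + b"] plus[of a b x] plus[of x y b] by (simp add: add.commute)
  show "(a, b) \<in> \<sigma> \<Longrightarrow> (x * a, x * b) \<in> \<sigma>" by (rule mult)
qed

lemma semiring_congruence_sum:
  assumes "semiring_congruence \<sigma>" "\<And>i. i \<in> I \<Longrightarrow> (g i, h i) \<in> \<sigma>"
  shows "(sum g I, sum h I) \<in> \<sigma>"
  using assms(2)
  by (induction I rule: infinite_finite_induct)
    (auto intro: semiring_congruenceD[OF assms(1)])

text \<open>
  Three congruences decide the case.  Equality after multiplication by \<open>a \<noteq> 0\<close> must be the identity,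
  so there are no zero divisors.  If no nonzero element has an additive inverse, then identifying all
  nonzero elements is a congruence, which must be the identity, and the semiring is Boolean.
  Otherwise the additively invertible elements are a nonzero ideal; the quotient by it is trivial, so
  \<open>1\<close> has a negative.  The semiring is then a ring, and its principal ideals show that it is a field.
\<close>

lemma congruence_simple_comm_semiring_cases:
  assumes simple: "\<And>\<sigma> :: ('s::comm_semiring_1 \<times> 's) set.
    semiring_congruence \<sigma> \<Longrightarrow> \<sigma> = Id \<or> (1, 0) \<in> \<sigma>"
  shows "is_field_semiring TYPE('s) \<or> is_boolean_semifield TYPE('s)"
proof -
  have cancel: "x = y" if "a \<noteq> 0" "a * x = a * y" for a x y :: 's
  proof -
    have "semiring_congruence {(x, y). a * x = a * y}"
      by (rule semiring_congruenceI) (auto simp: distrib_left mult.left_commute)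
    from simple[OF this] that show ?thesis by auto
  qed
  then have no_zero_divisors: "a * x = 0 \<longleftrightarrow> a = 0 \<or> x = 0" for a x :: 's
    by (metis mult_zero_left mult_zero_right)
  show ?thesis
  proof (cases "\<forall>a b :: 's. a + b = 0 \<longrightarrow> a = 0")
    case True
    then have zerosumfree: "a + b = 0 \<longleftrightarrow> a = 0 \<and> b = 0" for a b :: 's
      by (metis add.commute add.right_neutral)
    have "semiring_congruence {(x :: 's, y). x = 0 \<longleftrightarrow> y = 0}"
      by (rule semiring_congruenceI) (auto simp: zerosumfree no_zero_divisors)
    from simple[OF this] have two: "x \<noteq> 0 \<Longrightarrow> y \<noteq> 0 \<Longrightarrow> x = y" for x y :: 's by auto
    have "(1::'s) + 1 \<noteq> 0" using zerosumfree[of 1 1] by simp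
    then have "(1::'s) + 1 = 1" using two by auto
    moreover have "(UNIV :: 's set) = {0, 1}" using two by auto
    ultimately show ?thesis by (auto simp: is_boolean_semifield_def)
  next
    case False
    then obtain a\<^sub>0 b\<^sub>0 :: 's where ab: "a\<^sub>0 + b\<^sub>0 = 0" "a\<^sub>0 \<noteq> 0" by auto
    have "semiring_congruence {(x :: 's, y). \<exists>i j. i + j = 0 \<and> x + i = y}"
    proof (rule semiring_congruenceI; clarsimp)
      fix x show "\<exists>i. (\<exists>j. i + j = 0) \<and> x + i = (x::'s)"
        by (rule exI[of _ 0]) auto
    next
      fix x i j :: 's assume "i + j = 0"
      then have "j + i = 0" "x + i + j = x" by (metis add.commute, metis add.assoc add_0_right)
      then show "\<exists>i'. (\<exists>j. i' + j = 0) \<and> x + i + i' = x" by blast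
    next
      fix x i j i' j' :: 's assume "i + j = 0" "i' + j' = 0"
      moreover have "(i + i') + (j + j') = (i + j) + (i' + j')" by (simp only: ac_simps)
      ultimately have "(i + i') + (j + j') = 0" by simp
      then show "\<exists>k. (\<exists>j. k + j = 0) \<and> x + k = x + i + i'"
        by (intro exI[of _ "i + i'"]) (auto simp: add.assoc)
    next
      fix x a i j :: 's assume "i + j = 0"
      then show "\<exists>k. (\<exists>j. k + j = 0) \<and> x + a + k = x + (a + i)"
        by (intro exI[of _ i]) (auto simp: add.assoc)
    next
      fix x a i j :: 's assume "i + j = 0"
      then have "x * i + x * j = 0" by (simp flip: distrib_left)
      then show "\<exists>k. (\<exists>j. k + j = 0) \<and> x * a + k = x * (a + i)"
        by (intro exI[of _ "x * i"]) (auto simp: distrib_left)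
    qed
    moreover have "(a\<^sub>0, 0) \<in> {(x :: 's, y). \<exists>i j. i + j = 0 \<and> x + i = y}"
      using ab(1) add.commute[of a\<^sub>0 b\<^sub>0] by auto
    ultimately obtain n :: 's where n: "1 + n = 0" 
      using simple[of "{(x, y). \<exists>i j. i + j = 0 \<and> x + i = y}"] ab(2) by auto
    have neg: "a + a * n = 0" for a
      using arg_cong[OF n, of "(*) a"] by (simp add: distrib_left)
    have "\<exists>b. a * b = 1" if a: "a \<noteq> 0" for a :: 's
    proof -
      have "semiring_congruence {(x :: 's, y). \<exists>s. x = y + a * s}"
      proof (rule semiring_congruenceI; clarsimp)
        fix x show "\<exists>s. x = x + a * s" by (rule exI[of _ 0]) auto
      next
        fix y s
        have "a * s + a * (s * n) = 0" using neg[of "a * s"] by (simp add: mult.assoc)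
        then show "\<exists>s'. y = y + a * s + a * s'" 
          by (intro exI[of _ "s * n"]) (auto simp: add.assoc)
      next
        fix z s s' show "\<exists>s''. z + a * s' + a * s = z + a * s''"
          by (rule exI[of _ "s' + s"]) (auto simp: algebra_simps)
      next
        fix x b s show "\<exists>s'. x + (b + a * s) = x + b + a * s'"
          by (rule exI[of _ s]) (auto simp: algebra_simps)
      next
        fix x b s show "\<exists>s'. x * (b + a * s) = x * b + a * s'"
          by (rule exI[of _ "x * s"]) (auto simp: algebra_simps)
      qed
      moreover have "(a, 0) \<in> {(x :: 's, y). \<exists>s. x = y + a * s}"
        by (auto intro!: exI[of _ 1])
      ultimately have "(1, 0) \<in> {(x :: 's, y). \<exists>s. x = y + a * s}"
        using simple a by (metis pair_in_Id_conv)
      then obtain s where "1 = 0 + a * s" by blast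
      then show ?thesis by (metis add_0)
    qed
    then show ?thesis using neg unfolding is_field_semiring_def by blast
  qed
qed


section \<open>Partial transformations and the congruences they define\<close>

text \<open>
  Each generator is a partial transformation of a set of points.  A word acts by composition from left
  to right on points, so that on functions its last letter acts first.
\<close>

fun trace :: "('g \<Rightarrow> 'y \<Rightarrow> 'y option) \<Rightarrow> 'g list \<Rightarrow> 'y \<Rightarrow> 'y option" where
  "trace \<tau> [] y = Some y"
| "trace \<tau> (g # gs) y = Option.bind (\<tau> g y) (trace \<tau> gs)"

lemma trace_append: "trace \<tau> (us @ ws) y = Option.bind (trace \<tau> us y) (trace \<tau> ws)"
  by (induction us arbitrary: y) (auto simp: Option.bind_assoc cong: Option.bind_cong)

definition pull :: "('y \<Rightarrow> 's::zero) \<Rightarrow> 'y option \<Rightarrow> 's" where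
  "pull f z = (case z of None \<Rightarrow> 0 | Some y \<Rightarrow> f y)"

lemma pull_simps [simp]: "pull f None = 0" "pull f (Some y) = f y"
  by (simp_all add: pull_def)

text \<open>
  The linear extension to the free algebra, as operators on functions.  Operators do
  not need any finiteness of the set of points, unlike matrices indexed by it.
\<close>

definition act :: "('g \<Rightarrow> 'y \<Rightarrow> 'y option) \<Rightarrow> ('s::comm_semiring_1, 'g) free_elem
    \<Rightarrow> ('y \<Rightarrow> 's) \<Rightarrow> 'y \<Rightarrow> 's" where
  "act \<tau> p f y =
     (\<Sum>w \<in> Poly_Mapping.keys p. Poly_Mapping.lookup p w * pull f (trace \<tau> (letters w) y))"

lemma act_superset:
  assumes "finite K" "Poly_Mapping.keys p \<subseteq> K"
  shows "act \<tau> p f y = (\<Sum>w \<in> K. Poly_Mapping.lookup p w * pull f (trace \<tau> (letters w) y))"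
  unfolding act_def using assms
  by (intro sum.mono_neutral_left) (auto simp: in_keys_iff)

lemma act_zero [simp]: "act \<tau> 0 f y = 0"
  by (simp add: act_def)

lemma act_plus: "act \<tau> (p + q) f y = act \<tau> p f y + act \<tau> q f y"
proof -
  let ?K = "Poly_Mapping.keys p \<union> Poly_Mapping.keys q"
  have "finite ?K" by simp
  moreover have "Poly_Mapping.keys (p + q) \<subseteq> ?K" by (rule keys_add)
  ultimately show ?thesis
    by (simp add: act_superset[where K = ?K] lookup_add distrib_right sum.distrib)
qed

lemma act_sum: "act \<tau> (sum h I) f y = (\<Sum>i\<in>I. act \<tau> (h i) f y)"
  by (induction I rule: infinite_finite_induct) (auto simp: act_plus)

lemma act_single:
  "act \<tau> (Poly_Mapping.single w c) f y = c * pull f (trace \<tau> (letters w) y)"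
  using act_superset[of "{w}" "Poly_Mapping.single w c" \<tau> f y] by simp

lemma act_free_scale: "act \<tau> (free_scale c p) f y = c * act \<tau> p f y"
  by (subst act_superset[of "Poly_Mapping.keys p"])
    (auto simp: act_def in_keys_iff lookup_free_scale sum_distrib_left mult.assoc)

lemma sum_singles: "(\<Sum>w\<in>Poly_Mapping.keys p. Poly_Mapping.single w (Poly_Mapping.lookup p w)) = p"
  by (rule poly_mapping_eqI) (auto simp: lookup_sum lookup_single when_def in_keys_iff)

lemma act_mult:
  fixes p q :: "('s::comm_semiring_1, 'g) free_elem"
  shows "act \<tau> (p * q) f y = act \<tau> p (act \<tau> q f) y"
proof -
  have pull_sum: "pull (\<lambda>y. \<Sum>w\<in>K. h w y) z = (\<Sum>w\<in>K. pull (h w) z)" for K h z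
    by (cases z) auto
  have pull_mult: "pull (\<lambda>y. c * h y) z = c * pull h z" for c :: 's and h z
    by (cases z) auto
  have pull_bind: "pull f (Option.bind z g) = pull (\<lambda>y. pull f (g y)) z" for g z
    by (cases z) auto
  have single: "act \<tau> (Poly_Mapping.single u c * Poly_Mapping.single w d) f y =
      c * pull (act \<tau> (Poly_Mapping.single w d) f) (trace \<tau> (letters u) y)" for u w c d y
    by (simp add: mult_single act_single[abs_def] trace_append pull_bind pull_mult mult.assoc)
  have act_eq: "act \<tau> q f = (\<lambda>y. \<Sum>w\<in>Poly_Mapping.keys q. 
      act \<tau> (Poly_Mapping.single w (Poly_Mapping.lookup q w)) f y)" for q f
    using sum_singles[of q] act_sum by metis
  have "act \<tau> (p * q) f y = act \<tau>
      ((\<Sum>u\<in>Poly_Mapping.keys p. Poly_Mapping.single u (Poly_Mapping.lookup p u)) *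
       (\<Sum>w\<in>Poly_Mapping.keys q. Poly_Mapping.single w (Poly_Mapping.lookup q w))) f y"
    by (simp only: sum_singles)
  also have "\<dots> = (\<Sum>u\<in>Poly_Mapping.keys p. \<Sum>w\<in>Poly_Mapping.keys q.
      Poly_Mapping.lookup p u *
      pull (act \<tau> (Poly_Mapping.single w (Poly_Mapping.lookup q w)) f) (trace \<tau> (letters u) y))"
    by (simp only: sum_product act_sum single)
  also have "\<dots> = act \<tau> p (act \<tau> q f) y"
    by (subst act_def[of \<tau> p], subst act_eq[of q]) (simp add: pull_sum sum_distrib_left)
  finally show ?thesis .
qed

text \<open>
  A word replaces the argument by another point or gives zero, and so preserves pointwise congruence; this
  makes agreement modulo \<open>\<sigma>\<close> compatible with multiplication from the left.
\<close>

lemma act_congruence: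
  assumes \<sigma>: "semiring_congruence \<sigma>" and "\<And>y. (f y, g y) \<in> \<sigma>"
  shows "(act \<tau> p f y, act \<tau> p g y) \<in> \<sigma>"
  unfolding act_def
proof (intro semiring_congruence_sum[OF \<sigma>] semiring_congruenceD(5)[OF \<sigma>])
  fix w show "(pull f (trace \<tau> (letters w) y), pull g (trace \<tau> (letters w) y)) \<in> \<sigma>"
    using assms(2) semiring_congruenceD(1)[OF \<sigma>] by (cases "trace \<tau> (letters w) y") auto
qed

definition satisfies_relations :: "('g \<Rightarrow> 'y \<Rightarrow> 'y option) \<Rightarrow>
    (('s::comm_semiring_1, 'g) free_elem \<times> ('s, 'g) free_elem) set \<Rightarrow> bool" where
  "satisfies_relations \<tau> Rel \<longleftrightarrow> (\<forall>(p, q) \<in> Rel. act \<tau> p = act \<tau> q)"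

lemma act_generated_congruence:
  assumes "satisfies_relations \<tau> Rel" "(p, q) \<in> generated_congruence X Rel"
  shows "act \<tau> p = act \<tau> q"
  using assms(2)
proof (induction rule: generated_congruence.induct)
  case (base p q)
  with assms(1) show ?case by (auto simp: satisfies_relations_def)
qed (auto simp: act_plus act_mult act_free_scale intro!: ext)

text \<open>
  Agreement of actions modulo \<open>\<sigma>\<close> is a congruence of the presented algebra.  The element \<open>r\<close> is not
  related to zero, so in a congruence-simple algebra only equal elements are related.
\<close>

lemma presented_algebra_cong_if_acts_agree:
  fixes p q :: "('s::comm_semiring_1, 'g) free_elem"
  assumes simple: "congruence_simple (presented_algebra X Rel)"
    and \<tau>: "satisfies_relations \<tau> Rel" and \<sigma>: "semiring_congruence \<sigma>"
    and r: "r \<in> free_algebra X" "(act \<tau> r f y, 0) \<notin> \<sigma>"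
    and p: "p \<in> free_algebra X" and q: "q \<in> free_algebra X"
    and agree: "\<And>f y. (act \<tau> p f y, act \<tau> q f y) \<in> \<sigma>"
  shows "(p, q) \<in> generated_congruence X Rel"
proof -
  define \<theta> where "\<theta> = generated_congruence X Rel"
  let ?A = "presented_algebra X Rel"
  define cl where "cl p = \<theta> `` {p}" for p
  note ops = presented_algebra_ops[of _ X _ Rel, folded \<theta>_def, folded cl_def]
  have eq: "equiv (free_algebra X) \<theta>"
    unfolding \<theta>_def by (rule equiv_generated_congruence)
  have carrier: "hcarrier ?A = free_algebra X // \<theta>"
    by (simp add: presented_algebra_def Let_def \<theta>_def)
  have cl_closed: "p \<in> free_algebra X \<Longrightarrow> cl p \<in> free_algebra X // \<theta>" for p
    unfolding cl_def by (rule quotientI)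
  have cl_cases: "(\<And>p. p \<in> free_algebra X \<Longrightarrow> P = cl p \<Longrightarrow> thesis) \<Longrightarrow> thesis"
    if "P \<in> free_algebra X // \<theta>" for P thesis
    using that unfolding cl_def by (blast elim: quotientE)
  define agreeing where "agreeing p q \<longleftrightarrow> (\<forall>f y. (act \<tau> p f y, act \<tau> q f y) \<in> \<sigma>)" for p q
  note \<sigma>D = semiring_congruenceD[OF \<sigma>]
  define \<rho> where "\<rho> = {(P, Q). \<exists>p q. p \<in> free_algebra X \<and> q \<in> free_algebra X \<and>
    P = cl p \<and> Q = cl q \<and> agreeing p q}"
  have cls: "cl p = cl q \<Longrightarrow> p \<in> free_algebra X \<Longrightarrow> q \<in> free_algebra X \<Longrightarrow> act \<tau> p = act \<tau> q"
    for p q using eq_equiv_class[OF _ eq] act_generated_congruence[OF \<tau>] unfolding \<theta>_def cl_def by metis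
  \<comment> \<open>Agreement does not depend on representatives, because the action factors through the algebra.\<close>
  have \<rho>_iff: "(cl p, cl q) \<in> \<rho> \<longleftrightarrow> agreeing p q"
    if "p \<in> free_algebra X" "q \<in> free_algebra X" for p q
  proof
    assume "(cl p, cl q) \<in> \<rho>"
    then obtain p' q' where p': "cl p = cl p'" "p' \<in> free_algebra X"
      and q': "cl q = cl q'" "q' \<in> free_algebra X" and agr: "agreeing p' q'"
      unfolding \<rho>_def by blast
    show "agreeing p q"
      using agr unfolding agreeing_def cls[OF p'(1) that(1) p'(2)] cls[OF q'(1) that(2) q'(2)] .
  next
    show "(cl p, cl q) \<in> \<rho>" if "agreeing p q"
      using that \<open>p \<in> _\<close> \<open>q \<in> _\<close> unfolding \<rho>_def by blast
  qed
  have "hemiring_congruence ?A \<rho>"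
    unfolding hemiring_congruence_def
  proof (intro conjI ballI)
    show "equiv (hcarrier ?A) \<rho>"
    proof (rule equivI)
      show "\<rho> \<subseteq> hcarrier ?A \<times> hcarrier ?A"
        unfolding \<rho>_def carrier by (auto intro: cl_closed)
      show "refl_on (hcarrier ?A) \<rho>"
        unfolding carrier
        by (auto intro!: refl_onI elim!: cl_cases simp: \<rho>_iff agreeing_def \<sigma>D(1))
      show "sym \<rho>"
        unfolding \<rho>_def agreeing_def by (rule symI, clarify) (metis \<sigma>D(2))
      show "trans \<rho>"
      proof (rule transI)
        fix P Q R assume "(P, Q) \<in> \<rho>" "(Q, R) \<in> \<rho>"
        then obtain p q q' r where "p \<in> free_algebra X" "q \<in> free_algebra X"
          "q' \<in> free_algebra X" "r \<in> free_algebra X" "P = cl p" "Q = cl q"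
          "Q = cl q'" "R = cl r" "agreeing p q" "agreeing q' r"
          unfolding \<rho>_def by auto
        moreover from this have "act \<tau> q = act \<tau> q'" using cls by metis
        ultimately have "agreeing p r" unfolding agreeing_def using \<sigma>D(3) by metis
        with \<open>p \<in> _\<close> \<open>r \<in> _\<close> \<open>P = _\<close> \<open>R = _\<close> show "(P, R) \<in> \<rho>" by (simp add: \<rho>_iff)
      qed
    qed
  next
    fix T PQ assume "T \<in> hcarrier ?A" "PQ \<in> \<rho>"
    then obtain t p q where *: "t \<in> free_algebra X" "p \<in> free_algebra X" "q \<in> free_algebra X"
      "T = cl t" "PQ = (cl p, cl q)" "agreeing p q"
      unfolding \<rho>_def carrier by (auto elim!: cl_cases)
    have "agreeing (t + p) (t + q)" "agreeing (t * p) (t * q)" "agreeing (p * t) (q * t)"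
      using *(6) unfolding agreeing_def act_plus act_mult
      by (auto intro!: \<sigma>D(4) \<sigma>D(1) act_congruence[OF \<sigma>])
    with * show "case PQ of (P, Q) \<Rightarrow> (hplus ?A T P, hplus ?A T Q) \<in> \<rho> \<and>
        (hmult ?A T P, hmult ?A T Q) \<in> \<rho> \<and> (hmult ?A P T, hmult ?A Q T) \<in> \<rho>"
      by (simp add: ops free_algebra_plus free_algebra_mult \<rho>_iff)
  qed
  with simple have "\<rho> = Id_on (hcarrier ?A) \<or> \<rho> = hcarrier ?A \<times> hcarrier ?A"
    unfolding congruence_simple_def by blast
  moreover have "\<rho> \<noteq> hcarrier ?A \<times> hcarrier ?A"
  proof
    assume "\<rho> = hcarrier ?A \<times> hcarrier ?A"
    then have "(cl r, cl 0) \<in> \<rho>"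
      using r(1) free_algebra_zero unfolding carrier by (auto intro: cl_closed)
    with r show False
      using \<rho>_iff[OF r(1) free_algebra_zero] unfolding agreeing_def by (metis act_zero)
  qed
  moreover have "(cl p, cl q) \<in> \<rho>"
    using agree by (simp add: \<rho>_iff p q agreeing_def)
  ultimately have "cl p = cl q" by auto
  then show ?thesis using eq_equiv_class[OF _ eq q] unfolding \<theta>_def cl_def by blast
qed


section \<open>Leavitt path algebras act on the integer points over a set of vertices\<close>

lemma trace_singleton [simp]: "trace \<tau> [x] = \<tau> x"
proof
  show "trace \<tau> [x] y = \<tau> x y" for y by (cases "\<tau> x y") auto
qed

lemma act_gen [simp]: "act \<tau> (gen x) f y = pull f (\<tau> x y)"
  by (simp add: gen_def act_single del: trace.simps)

lemma act_gen_gen [simp]: "act \<tau> (gen x * gen z) f y = pull f (Option.bind (\<tau> x y) (\<tau> z))"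
  by (simp add: gen_def act_single mult_single plus_free_word_def trace_append[of _ "[x]" "[z]", simplified append.simps] del: trace.simps)

definition live_arcs :: "('v, 'e) pre_digraph \<Rightarrow> 'v set \<Rightarrow> 'v \<Rightarrow> 'e set" where
  "live_arcs G W v = {e \<in> out_arcs G v. head G e \<in> W}"

definition arc_index :: "('v, 'e) pre_digraph \<Rightarrow> 'v set \<Rightarrow> 'e \<Rightarrow> int" where
  "arc_index G W e = int (to_nat_on (live_arcs G W (tail G e)) e)"

text \<open>
  The bijection \<open>\<int> \<times> {0..<d} \<cong> \<int>\<close>, \<open>(n, i) \<mapsto> n d + i\<close>, splits the copy of the integers over a vertex
  into one copy for each of its \<open>d\<close> arcs.  For \<open>d = 1\<close> it is the identity, so that without the shift \<open>\<delta>\<close> an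
  arc that is alone at its source does not move the integer.
\<close>

fun branching :: "('v, 'e) pre_digraph \<Rightarrow> 'v set \<Rightarrow> int \<Rightarrow> ('v, 'e) leavitt_gen
    \<Rightarrow> 'v \<times> int \<Rightarrow> ('v \<times> int) option" where
  "branching G W \<delta> (Vertex v) (w, m) = (if w = v \<and> v \<in> W then Some (w, m) else None)"
| "branching G W \<delta> (Edge e) (w, m) =
    (let d = int (card (live_arcs G W w)) in
     if w = tail G e \<and> head G e \<in> W \<and> m mod d = arc_index G W e
     then Some (head G e, m div d - \<delta>) else None)"
| "branching G W \<delta> (Ghost e) (w, m) =
    (let d = int (card (live_arcs G W (tail G e))) in
     if w = head G e \<and> w \<in> W then Some (tail G e, (m + \<delta>) * d + arc_index G W e) else None)"

lemma arc_index_bij: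
  assumes "finite (out_arcs G v)"
  shows "bij_betw (arc_index G W) (live_arcs G W v) {0..<int (card (live_arcs G W v))}"
proof -
  have "finite (live_arcs G W v)"
    by (rule finite_subset[OF _ assms]) (auto simp: live_arcs_def)
  then have "bij_betw (to_nat_on (live_arcs G W v)) (live_arcs G W v) {..<card (live_arcs G W v)}"
    by (rule to_nat_on_finite)
  moreover have "bij_betw int {..<card (live_arcs G W v)} {0..<int (card (live_arcs G W v))}"
    by (rule bij_betwI'[where f = int]) (auto intro: zero_le_imp_eq_int[elim_format])
  ultimately have "bij_betw (int \<circ> to_nat_on (live_arcs G W v)) (live_arcs G W v)
      {0..<int (card (live_arcs G W v))}" by (rule bij_betw_trans)
  then show ?thesis
    by (rule bij_betw_cong[THEN iffD1, rotated]) (auto simp: arc_index_def live_arcs_def)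
qed

text \<open>
  The hypotheses on \<open>W\<close> say that its complement is hereditary and saturated.  Saturation gives every regular vertex
  in \<open>W\<close> an arc into \<open>W\<close>, so that its copy of the integers is the disjoint union of the parts that
  belong to its arcs; this is the relation \<open>v = \<Sum> e e*\<close>.
\<close>

lemma branching_satisfies_leavitt_relations:
  fixes G :: "('v, 'e) pre_digraph"
  assumes "wf_digraph G" "row_finite G"
    and coher: "\<And>e. e \<in> arcs G \<Longrightarrow> head G e \<in> W \<Longrightarrow> tail G e \<in> W"
    and cosat: "\<And>v. v \<in> W \<Longrightarrow> regular_vertex G v \<Longrightarrow> live_arcs G W v \<noteq> {}"
  shows "satisfies_relations (branching G W \<delta>)
    (leavitt_relations G :: (('s::comm_semiring_1, ('v, 'e) leavitt_gen) free_elem \<times> _) set)"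
proof -
  interpret wf_digraph G by fact
  let ?d = "\<lambda>v. int (card (live_arcs G W v))"
  have bij: "bij_betw (arc_index G W) (live_arcs G W v) {0..<?d v}" if "v \<in> verts G" for v
    using that assms(2) by (intro arc_index_bij) (simp add: row_finite_def)
  have live: "e \<in> live_arcs G W (tail G e)" if "e \<in> arcs G" "head G e \<in> W" for e
    using that by (simp add: live_arcs_def)
  have index: "0 \<le> arc_index G W e \<and> arc_index G W e < ?d (tail G e)"
    if "e \<in> arcs G" "head G e \<in> W" for e
    using bij_betwE[OF bij[OF tail_in_verts[OF that(1)]]] live[OF that] by auto
  have index_inj: "e = f" if "e \<in> arcs G" "head G e \<in> W" "f \<in> arcs G" "head G f \<in> W"
      "tail G e = tail G f" "arc_index G W e = arc_index G W f" for e f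
    using bij_betw_imp_inj_on[OF bij[OF tail_in_verts[OF that(1)]]] live[OF that(1,2)]
      live[OF that(3,4)] that by (auto dest: inj_onD)
  have "act (branching G W \<delta>) p f (w, m) = act (branching G W \<delta>) q f (w, m)"
    if "(p, q) \<in> leavitt_relations G" for p q :: "('s, ('v, 'e) leavitt_gen) free_elem" and f w m
    using that
  proof cases
    case (vertex_vertex u v)
    then show ?thesis by auto
  next
    case (source_edge e)
    then show ?thesis using coher by (auto simp: Let_def)
  next
    case (edge_range e)
    then show ?thesis by (auto simp: Let_def)
  next
    case (range_ghost e)
    then show ?thesis by (auto simp: Let_def)
  next
    case (ghost_source e)
    then show ?thesis using coher by (auto simp: Let_def)
  next
    case (ghost_edge e g)
    let ?n = "(m + \<delta>) * ?d (tail G e) + arc_index G W e"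
    have *: "?n mod ?d (tail G e) = arc_index G W e" "?n div ?d (tail G e) = m + \<delta>"
      if "head G e \<in> W"
      using index[OF ghost_edge(3) that] by auto
    show ?thesis
    proof (cases "w = head G e \<and> w \<in> W")
      case True
      then show ?thesis using ghost_edge * index_inj[of e g]
        by (auto simp: Let_def simp del: mod_mult_self3 div_mult_self3)
    next
      case False
      then have "branching G W \<delta> (Ghost e) (w, m) = None"
        "branching G W \<delta> (Vertex (head G e)) (w, m) = None" by auto
      then show ?thesis unfolding ghost_edge(1,2) by (cases "e = g"; simp del: branching.simps)
    qed
  next
    case (regular v)
    have fin: "finite (out_arcs G v)" and v: "v \<in> verts G"
      using regular by (auto simp: regular_vertex_def)
    show ?thesis
    proof (cases "w = v \<and> v \<in> W")
      case False
      then have "Option.bind (branching G W \<delta> (Edge e) (w, m)) (branching G W \<delta> (Ghost e)) = None"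
        if "e \<in> out_arcs G v" for e
        using that coher[of e] by (auto simp: Let_def)
      with False regular show ?thesis by (auto simp: act_sum)
    next
      case True
      have "finite (live_arcs G W v)"
        by (rule finite_subset[OF _ fin]) (auto simp: live_arcs_def)
      with cosat True regular have d: "?d v > 0" by (auto simp: card_gt_0_iff)
      then have "m mod ?d v \<in> {0..<?d v}" by simp
      \<comment> \<open>The residue of \<open>m\<close> selects the only arc whose part contains \<open>(v, m)\<close>.\<close>
      then obtain e\<^sub>0 where e\<^sub>0: "e\<^sub>0 \<in> live_arcs G W v" "arc_index G W e\<^sub>0 = m mod ?d v"
        using bij_betw_imp_surj_on[OF bij[OF v]] by (metis imageE)
      have "pull f (Option.bind (branching G W \<delta> (Edge e) (w, m)) (branching G W \<delta> (Ghost e))) =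
          (if e = e\<^sub>0 then f (v, m) else 0)" if "e \<in> out_arcs G v" for e
      proof (cases "e = e\<^sub>0")
        case True
        have e: "head G e \<in> W" "tail G e = v" "arc_index G W e = m mod ?d v"
          using e\<^sub>0 True by (auto simp: live_arcs_def)
        have "branching G W \<delta> (Edge e) (v, m) = Some (head G e, m div ?d v - \<delta>)"
          using e by (simp add: Let_def)
        moreover have "branching G W \<delta> (Ghost e) (head G e, m div ?d v - \<delta>) = Some (v, m)"
          using e by (simp add: Let_def)
        ultimately show ?thesis
          using True \<open>w = v \<and> v \<in> W\<close> by (simp del: branching.simps)
      next
        case False
        have "branching G W \<delta> (Edge e) (v, m) = None"
        proof (rule ccontr)
          assume "\<not> ?thesis"
          then have "head G e \<in> W" "arc_index G W e = m mod ?d v"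
            by (auto simp: Let_def split: if_splits)
          with that e\<^sub>0 index_inj[of e e\<^sub>0] False show False by (simp add: live_arcs_def)
        qed
        with False \<open>w = v \<and> v \<in> W\<close> show ?thesis by (simp del: branching.simps)
      qed
      then have "(\<Sum>e\<in>out_arcs G v. pull f
          (Option.bind (branching G W \<delta> (Edge e) (w, m)) (branching G W \<delta> (Ghost e)))) = f (v, m)"
        using e\<^sub>0(1) fin by (simp add: live_arcs_def sum.delta)
      with True regular show ?thesis by (simp add: act_sum)
    qed
  qed
  then show ?thesis unfolding satisfies_relations_def by (auto intro!: ext)
qed

lemma trace_exitless_walk:
  assumes "wf_digraph G" "pre_digraph.awalk G u p v"
    and "\<And>e. e \<in> set p \<Longrightarrow> out_arcs G (tail G e) = {e}"
  shows "trace (branching G (verts G) \<delta>) (map Edge p) (u, m) = Some (v, m - \<delta> * int (length p))"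
  using assms(2,3)
proof (induction p arbitrary: u m)
  case Nil
  then show ?case using wf_digraph.awalk_Nil_iff[OF assms(1)] by simp
next
  case (Cons e p)
  interpret wf_digraph G by fact
  have e: "e \<in> arcs G" "tail G e = u" "awalk (head G e) p v"
    using Cons.prems(1) by (auto simp: awalk_Cons_iff)
  have live: "live_arcs G (verts G) u = {e}"
    using Cons.prems(2)[of e] e by (auto simp: live_arcs_def)
  have "arc_index G (verts G) e \<in> {0..<1}"
    using bij_betwE[OF arc_index_bij[of G u "verts G"]] Cons.prems(2)[of e] e live by simp
  then show ?case
    using Cons.IH[OF e(3) Cons.prems(2)] e live by (simp add: Let_def algebra_simps)
qed

lemma semiring_congruence_Id: "semiring_congruence Id"
  by (rule semiring_congruenceI) auto

context
  fixes G :: "('v, 'e) pre_digraph"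
  assumes wf: "wf_digraph G" and nonempty: "verts G \<noteq> {}" and row_finite: "row_finite G"
begin

lemma full_branching:
  "satisfies_relations (branching G (verts G) \<delta>)
    (leavitt_relations G :: (('s::comm_semiring_1, ('v, 'e) leavitt_gen) free_elem \<times> _) set)"
proof (rule branching_satisfies_leavitt_relations[OF wf row_finite])
  interpret wf_digraph G by (rule wf)
  show "e \<in> arcs G \<Longrightarrow> tail G e \<in> verts G" for e by simp
  show "regular_vertex G v \<Longrightarrow> live_arcs G (verts G) v \<noteq> {}" for v
    by (auto simp: regular_vertex_def live_arcs_def)
qed

text \<open>
  If \<open>\<sigma>\<close> relates \<open>a\<close> to \<open>b\<close>, then the multiples \<open>a v\<close> and \<open>b v\<close> of a vertex agree modulo \<open>\<sigma>\<close>; if they are equal, then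
  their actions on a constant function show that \<open>a = b\<close>.
\<close>

lemma congruence_simple_coefficients:
  assumes simple: "congruence_simple (leavitt_path_algebra TYPE('s::comm_semiring_1) G)"
  shows "is_field_semiring TYPE('s) \<or> is_boolean_semifield TYPE('s)"
proof (rule congruence_simple_comm_semiring_cases)
  fix \<sigma> :: "('s \<times> 's) set" assume \<sigma>: "semiring_congruence \<sigma>"
  note \<sigma>D = semiring_congruenceD[OF \<sigma>]
  obtain v where v: "v \<in> verts G" using nonempty by auto
  let ?X = "leavitt_generators G"
  let ?\<tau> = "branching G (verts G) 0"
  have gen_v: "(gen (Vertex v) :: ('s, ('v, 'e) leavitt_gen) free_elem) \<in> free_algebra ?X"
    using v by (intro gen_in_free_algebra) (auto simp: leavitt_generators_def)
  have "a = b" if "(1, 0) \<notin> \<sigma>" "(a, b) \<in> \<sigma>" for a b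
  proof -
    have "(free_scale a (gen (Vertex v)), free_scale b (gen (Vertex v)))
        \<in> generated_congruence ?X (leavitt_relations G)"
    proof (rule presented_algebra_cong_if_acts_agree
        [OF simple[unfolded leavitt_path_algebra_def] full_branching \<sigma> gen_v])
      show "(act ?\<tau> (gen (Vertex v)) (\<lambda>_. 1) (v, 0), 0) \<notin> \<sigma>" using that v by simp
      show "(act ?\<tau> (free_scale a (gen (Vertex v))) f y,
          act ?\<tau> (free_scale b (gen (Vertex v))) f y) \<in> \<sigma>" for f y
        using \<sigma>D(5)[OF that(2), of "act ?\<tau> (gen (Vertex v)) f y"]
        by (simp add: act_free_scale mult.commute del: act_gen)
    qed (simp_all add: free_algebra_scale gen_v)
    from act_generated_congruence[OF full_branching this]
    have "act ?\<tau> (free_scale a (gen (Vertex v))) (\<lambda>_. 1) (v, 0) =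
        act ?\<tau> (free_scale b (gen (Vertex v))) (\<lambda>_. 1) (v, 0)" by metis
    then show ?thesis using v by (simp add: act_free_scale)
  qed
  then show "\<sigma> = Id \<or> (1, 0) \<in> \<sigma>" using \<sigma>D(1) by auto
qed

text \<open>
  A vertex in \<open>H\<close> acts as zero on the points over the complement of \<open>H\<close>, where other vertices
  survive, but not on the points over all vertices.
\<close>

lemma congruence_simple_hereditary_saturated:
  assumes simple: "congruence_simple (leavitt_path_algebra TYPE('s::comm_semiring_1) G)"
    and H: "H \<subseteq> verts G" "hereditary G H" "saturated G H"
  shows "H = {} \<or> H = verts G"
proof (rule ccontr)
  assume "\<not> ?thesis"
  with H(1) obtain v w where v: "v \<in> H" "v \<in> verts G" and w: "w \<in> verts G" "w \<notin> H" by auto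
  interpret wf_digraph G by (rule wf)
  let ?X = "leavitt_generators G"
  let ?W = "verts G - H"
  have gens: "(gen (Vertex u) :: ('s, ('v, 'e) leavitt_gen) free_elem) \<in> free_algebra ?X"
    if "u \<in> verts G" for u
    using that by (intro gen_in_free_algebra) (auto simp: leavitt_generators_def)
  have sat: "satisfies_relations (branching G ?W 0)
    (leavitt_relations G :: (('s, ('v, 'e) leavitt_gen) free_elem \<times> _) set)"
  proof (rule branching_satisfies_leavitt_relations[OF wf row_finite])
    show "e \<in> arcs G \<Longrightarrow> head G e \<in> ?W \<Longrightarrow> tail G e \<in> ?W" for e
      using H(2) unfolding hereditary_def by auto
    show "live_arcs G ?W u \<noteq> {}" if "u \<in> ?W" "regular_vertex G u" for u
    proof -
      have "\<not> head G ` out_arcs G u \<subseteq> H" using H(3) that unfolding saturated_def by blast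
      then show ?thesis by (auto simp: live_arcs_def)
    qed
  qed
  have "(gen (Vertex v) :: ('s, ('v, 'e) leavitt_gen) free_elem, 0)
      \<in> generated_congruence ?X (leavitt_relations G)"
  proof (rule presented_algebra_cong_if_acts_agree
      [OF simple[unfolded leavitt_path_algebra_def] sat semiring_congruence_Id gens[OF w(1)]])
    show "(act (branching G ?W 0) (gen (Vertex w)) (\<lambda>_. 1) (w, 0), 0) \<notin> Id"
      using w by simp
    show "(act (branching G ?W 0) (gen (Vertex v)) f y, act (branching G ?W 0) 0 f y) \<in> Id" for f y
      using v by (cases y) simp
  qed (simp_all add: gens v free_algebra_zero)
  from act_generated_congruence[OF full_branching this, of 0]
  have "act (branching G (verts G) 0) (gen (Vertex v)) (\<lambda>_. 1 :: 's) (v, 0) = 0" by simp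
  then show False using v by simp
qed

text \<open>
  The actions with \<open>\<delta> = 0\<close> and \<open>\<delta> = 1\<close> differ by the degree of paths.  A cycle without exit and its base vertex
  differ only in degree, so they agree in the first action and not in the second.
\<close>

lemma congruence_simple_cycle_has_exit:
  assumes simple: "congruence_simple (leavitt_path_algebra TYPE('s::comm_semiring_1) G)"
    and cycle: "pre_digraph.cycle G c"
  shows "\<exists>f. is_exit G f c"
proof (rule ccontr)
  assume no_exit: "\<not> ?thesis"
  interpret wf_digraph G by (rule wf)
  obtain u where c: "awalk u c u" "c \<noteq> []" using cycle cycle_iff_distinct_sources by metis
  then have u: "u \<in> verts G" and arcs: "set c \<subseteq> arcs G" by auto
  have out: "out_arcs G (tail G e) = {e}" if e: "e \<in> set c" for e
  proof -
    have "f = e" if "f \<in> arcs G" "tail G f = tail G e" for f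
      using no_exit that e unfolding is_exit_def by (metis in_set_conv_nth)
    then show ?thesis using e arcs by auto
  qed
  let ?X = "leavitt_generators G"
  let ?c = "Poly_Mapping.single (Free_Word (map Edge c)) 1 :: ('s, ('v, 'e) leavitt_gen) free_elem"
  have gen_u: "(gen (Vertex u) :: ('s, ('v, 'e) leavitt_gen) free_elem) \<in> free_algebra ?X"
    using u by (intro gen_in_free_algebra) (auto simp: leavitt_generators_def)
  have c_free: "?c \<in> free_algebra ?X"
    using c arcs by (auto simp: free_algebra_def leavitt_generators_def)
  have tr: "trace (branching G (verts G) \<delta>) (map Edge c) (u, m) = Some (u, m - \<delta> * int (length c))"
    for \<delta> m using trace_exitless_walk[OF wf c(1) out] by simp
  have tr_other: "trace (branching G (verts G) \<delta>) (map Edge c) (w, m) = None" if "w \<noteq> u" for \<delta> m w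
    using that c by (cases c) (auto simp: awalk_Cons_iff Let_def)
  have "(?c, gen (Vertex u)) \<in> generated_congruence ?X (leavitt_relations G)"
  proof (rule presented_algebra_cong_if_acts_agree
      [OF simple[unfolded leavitt_path_algebra_def] full_branching semiring_congruence_Id gen_u])
    show "(act (branching G (verts G) 0) (gen (Vertex u)) (\<lambda>_. 1) (u, 0), 0) \<notin> Id"
      using u by simp
    show "(act (branching G (verts G) 0) ?c f y, act (branching G (verts G) 0) (gen (Vertex u)) f y)
        \<in> Id" for f y
      using u tr tr_other by (cases y; cases "fst y = u") (auto simp: act_single)
  qed (simp_all add: gen_u c_free)
  from act_generated_congruence[OF full_branching this, of 1]
  have "act (branching G (verts G) 1) ?c (\<lambda>y. if y = (u, 0) then 1 else 0) (u, 0) =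
      act (branching G (verts G) 1) (gen (Vertex u)) (\<lambda>y. if y = (u, 0) then 1 else 0) (u, 0)"
    by metis
  then show False using u c(2) by (simp add: act_single tr)
qed

end


section \<open>Calculating with paths and ghost paths\<close>

text \<open>
  The locale fixes the type of coefficients, which a congruence between words would otherwise not
  determine.  Calculations take place in the free algebra, modulo the congruence that defines the Leavitt path algebra.
\<close>

locale leavitt_calculus = wf_digraph G for G :: "('v, 'e) pre_digraph" +
  fixes S :: "'s::comm_semiring_1 itself"
  assumes row_finite: "row_finite G"
begin

abbreviation X :: "('v, 'e) leavitt_gen set" where
  "X \<equiv> leavitt_generators G"

abbreviation A :: "('s, ('v, 'e) leavitt_gen) free_elem set" where
  "A \<equiv> free_algebra X"

definition cong :: "('s, ('v, 'e) leavitt_gen) free_elem \<Rightarrow>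
    ('s, ('v, 'e) leavitt_gen) free_elem \<Rightarrow> bool" (infix "\<simeq>" 50) where
  "p \<simeq> q \<longleftrightarrow> (p, q) \<in> generated_congruence X (leavitt_relations G)"

abbreviation mon :: "('v, 'e) leavitt_gen list \<Rightarrow> ('s, ('v, 'e) leavitt_gen) free_elem" where
  "mon ws \<equiv> Poly_Mapping.single (Free_Word ws) 1"

lemma cong_trans [trans]: "p \<simeq> q \<Longrightarrow> q \<simeq> r \<Longrightarrow> p \<simeq> r"
  unfolding cong_def by (rule generated_congruence.trans)

lemma cong_sym: "p \<simeq> q \<Longrightarrow> q \<simeq> p"
  unfolding cong_def by (rule generated_congruence.sym)

lemma cong_refl: "p \<in> A \<Longrightarrow> p \<simeq> p"
  unfolding cong_def by (rule generated_congruence.refl)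

lemma cong_closed: "p \<simeq> q \<Longrightarrow> p \<in> A" "p \<simeq> q \<Longrightarrow> q \<in> A"
  unfolding cong_def using generated_congruence_subset by blast+

lemma cong_mult_left: "p \<simeq> q \<Longrightarrow> r \<in> A \<Longrightarrow> r * p \<simeq> r * q"
  unfolding cong_def by (rule generated_congruence.mult_left)

lemma cong_mult_right: "p \<simeq> q \<Longrightarrow> r \<in> A \<Longrightarrow> p * r \<simeq> q * r"
  unfolding cong_def by (rule generated_congruence.mult_right)

lemma cong_plus:
  assumes "p \<simeq> p'" "q \<simeq> q'"
  shows "p + q \<simeq> p' + q'"
proof -
  have "p + q \<simeq> p + q'"
    using assms cong_closed unfolding cong_def by (blast intro: generated_congruence.plus)
  moreover have "q' + p \<simeq> q' + p'"
    using assms cong_closed unfolding cong_def by (blast intro: generated_congruence.plus)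
  ultimately show ?thesis by (metis add.commute cong_trans)
qed

lemma cong_scale: "p \<simeq> q \<Longrightarrow> free_scale c p \<simeq> free_scale c q"
  unfolding cong_def by (rule generated_congruence.scale)

lemma cong_sum: "(\<And>i. i \<in> I \<Longrightarrow> g i \<simeq> h i) \<Longrightarrow> sum g I \<simeq> sum h I"
  by (induction I rule: infinite_finite_induct)
    (auto intro: cong_refl free_algebra_zero cong_plus)

lemma mon_append: "mon (us @ ws) = mon us * mon ws"
  by (simp add: mult_single plus_free_word_def)

lemma mon_closed: "ws \<noteq> [] \<Longrightarrow> set ws \<subseteq> X \<Longrightarrow> mon ws \<in> A"
  by (auto simp: free_algebra_def)

lemma mon_Nil: "mon [] = 1"
  by (simp add: zero_free_word_def flip: single_one)

text \<open>
  The words around \<open>p\<close> may be empty.  The empty word is the unit of the ambient monoid algebra, but it is not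
  in the free nonunital algebra, so this is not an instance of compatibility with multiplication.
\<close>

lemma cong_context:
  assumes "p \<simeq> q" "set us \<subseteq> X" "set ws \<subseteq> X"
  shows "mon us * p * mon ws \<simeq> mon us * q * mon ws"
proof -
  have "mon us * p \<simeq> mon us * q"
    using assms(1,2) mon_closed[of us]
    by (cases "us = []") (auto simp: mon_Nil intro: cong_mult_left)
  then show ?thesis
    using assms(3) mon_closed[of ws]
    by (cases "ws = []") (auto simp: mon_Nil intro: cong_mult_right)
qed

lemma mon_context:
  assumes "mon vs \<simeq> mon vs'" "set us \<subseteq> X" "set ws \<subseteq> X"
  shows "mon (us @ vs @ ws) \<simeq> mon (us @ vs' @ ws)"
  using cong_context[OF assms] by (simp add: mon_append mult.assoc)

lemma mon_context_zero:
  assumes "mon vs \<simeq> 0" "set us \<subseteq> X" "set ws \<subseteq> X"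
  shows "mon (us @ vs @ ws) \<simeq> 0"
  using cong_context[OF assms] by (simp add: mon_append mult.assoc)

lemma gens [simp]:
  "v \<in> verts G \<Longrightarrow> Vertex v \<in> X" "e \<in> arcs G \<Longrightarrow> Edge e \<in> X" "e \<in> arcs G \<Longrightarrow> Ghost e \<in> X"
  by (auto simp: leavitt_generators_def)

lemma relation_cong: "(p, q) \<in> leavitt_relations G \<Longrightarrow> p \<simeq> q"
  using leavitt_relations_in_free_algebra[OF wf_digraph_axioms]
  unfolding cong_def by (auto intro: generated_congruence.base)

lemma letter_cong:
  "v \<in> verts G \<Longrightarrow> mon [Vertex v, Vertex v] \<simeq> mon [Vertex v]"
  "v \<in> verts G \<Longrightarrow> w \<in> verts G \<Longrightarrow> v \<noteq> w \<Longrightarrow> mon [Vertex v, Vertex w] \<simeq> 0"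
  "e \<in> arcs G \<Longrightarrow> mon [Vertex (tail G e), Edge e] \<simeq> mon [Edge e]"
  "e \<in> arcs G \<Longrightarrow> mon [Edge e, Vertex (head G e)] \<simeq> mon [Edge e]"
  "e \<in> arcs G \<Longrightarrow> mon [Vertex (head G e), Ghost e] \<simeq> mon [Ghost e]"
  "e \<in> arcs G \<Longrightarrow> mon [Ghost e, Vertex (tail G e)] \<simeq> mon [Ghost e]"
  "e \<in> arcs G \<Longrightarrow> mon [Ghost e, Edge e] \<simeq> mon [Vertex (head G e)]"
  "e \<in> arcs G \<Longrightarrow> f \<in> arcs G \<Longrightarrow> e \<noteq> f \<Longrightarrow> mon [Ghost e, Edge f] \<simeq> 0"
proof -
  note rel = leavitt_relations.intros[THEN relation_cong, unfolded gen_def mult_single plus_free_word_def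
      free_word.sel append.simps mult_1]
  show "v \<in> verts G \<Longrightarrow> mon [Vertex v, Vertex v] \<simeq> mon [Vertex v]"
    using rel(1)[of v v] by simp
  show "v \<in> verts G \<Longrightarrow> w \<in> verts G \<Longrightarrow> v \<noteq> w \<Longrightarrow> mon [Vertex v, Vertex w] \<simeq> 0"
    using rel(1)[of v w] by simp
  show "e \<in> arcs G \<Longrightarrow> mon [Vertex (tail G e), Edge e] \<simeq> mon [Edge e]"
    by (rule rel(2))
  show "e \<in> arcs G \<Longrightarrow> mon [Edge e, Vertex (head G e)] \<simeq> mon [Edge e]"
    by (rule rel(3))
  show "e \<in> arcs G \<Longrightarrow> mon [Vertex (head G e), Ghost e] \<simeq> mon [Ghost e]"
    by (rule rel(4))
  show "e \<in> arcs G \<Longrightarrow> mon [Ghost e, Vertex (tail G e)] \<simeq> mon [Ghost e]"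
    by (rule rel(5))
  show "e \<in> arcs G \<Longrightarrow> mon [Ghost e, Edge e] \<simeq> mon [Vertex (head G e)]"
    using rel(6)[of e e] by simp
  show "e \<in> arcs G \<Longrightarrow> f \<in> arcs G \<Longrightarrow> e \<noteq> f \<Longrightarrow> mon [Ghost e, Edge f] \<simeq> 0"
    using rel(6)[of e f] by simp
qed

text \<open>
  The vertex at the end records the range, so that trivial paths also have a nonempty word.  The
  product of the edge word of \<open>p\<close> with the ghost word of \<open>q\<close> represents \<open>p q*\<close> and contains the
  common range twice.
\<close>

definition edge_word :: "'e list \<Rightarrow> 'v \<Rightarrow> ('v, 'e) leavitt_gen list" where
  "edge_word p v = map Edge p @ [Vertex v]"

definition ghost_word :: "'e list \<Rightarrow> 'v \<Rightarrow> ('v, 'e) leavitt_gen list" where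
  "ghost_word q v = Vertex v # map Ghost (rev q)"

lemma word_simps [simp]:
  "edge_word (e # p) v = Edge e # edge_word p v"
  "ghost_word (e # q) v = ghost_word q v @ [Ghost e]"
  "edge_word [] v = [Vertex v]" "ghost_word [] v = [Vertex v]"
  by (simp_all add: edge_word_def ghost_word_def)

lemma awalk_arcs: "awalk u p v \<Longrightarrow> e \<in> set p \<Longrightarrow> e \<in> arcs G"
  by (auto elim: awalkE')

lemma awalk_letters:
  assumes "awalk u p v"
  shows "set (map Edge p) \<subseteq> X" "set (map Ghost (rev p)) \<subseteq> X"
  using awalk_arcs[OF assms] by auto

lemma word_closed [simp]:
  assumes "awalk u p v"
  shows "set (edge_word p v) \<subseteq> X" "set (ghost_word p v) \<subseteq> X" "edge_word p v \<noteq> []" "ghost_word p v \<noteq> []"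
  using assms awalk_arcs[OF assms] by (auto simp: edge_word_def ghost_word_def)

lemma source_edge_word:
  assumes "awalk u p v"
  shows "mon (Vertex u # edge_word p v) \<simeq> mon (edge_word p v)"
proof (cases p)
  case Nil
  with assms show ?thesis using letter_cong(1)[of v] by (auto simp: awalk_Nil_iff)
next
  case (Cons e p')
  with assms have "e \<in> arcs G" "tail G e = u" "awalk (head G e) p' v"
    by (auto simp: awalk_Cons_iff)
  with mon_context[OF letter_cong(3), of e "[]" "edge_word p' v"] Cons show ?thesis by simp
qed

lemma other_source_edge_word:
  assumes "awalk u p v" "w \<in> verts G" "w \<noteq> u"
  shows "mon (Vertex w # edge_word p v) \<simeq> 0"
proof -
  have "mon ([Vertex w] @ (Vertex u # edge_word p v) @ []) \<simeq> mon ([Vertex w] @ edge_word p v @ [])"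
    using assms by (intro mon_context source_edge_word) auto
  moreover have "mon ([] @ [Vertex w, Vertex u] @ edge_word p v) \<simeq> 0"
    using assms by (intro mon_context_zero letter_cong) auto
  ultimately show ?thesis by (auto intro: cong_trans cong_sym)
qed

lemma ghost_word_source:
  assumes "awalk u p v"
  shows "mon (ghost_word p v @ [Vertex u]) \<simeq> mon (ghost_word p v)"
proof (cases p)
  case Nil
  with assms show ?thesis using letter_cong(1)[of v] by (auto simp: awalk_Nil_iff)
next
  case (Cons e p')
  with assms have "e \<in> arcs G" "tail G e = u" "awalk (head G e) p' v"
    by (auto simp: awalk_Cons_iff)
  with mon_context[OF letter_cong(6), of e "ghost_word p' v" "[]"] Cons show ?thesis by simp
qed

lemma ghost_word_other_source:
  assumes "awalk u p v" "w \<in> verts G" "w \<noteq> u"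
  shows "mon (ghost_word p v @ [Vertex w]) \<simeq> 0"
proof -
  have "mon ([] @ (ghost_word p v @ [Vertex u]) @ [Vertex w]) \<simeq> mon ([] @ ghost_word p v @ [Vertex w])"
    using assms by (intro mon_context ghost_word_source) auto
  moreover have "mon (ghost_word p v @ [Vertex u, Vertex w] @ []) \<simeq> 0"
    using assms by (intro mon_context_zero letter_cong) auto
  ultimately show ?thesis by (auto intro: cong_trans cong_sym)
qed

lemma edge_word_append:
  assumes "awalk u p v" "awalk v q w"
  shows "mon (edge_word p v @ edge_word q w) \<simeq> mon (edge_word (p @ q) w)"
proof -
  have "mon (map Edge p @ (Vertex v # edge_word q w) @ []) \<simeq> mon (map Edge p @ edge_word q w @ [])"
    using assms awalk_letters[OF assms(1)] by (intro mon_context source_edge_word) auto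
  then show ?thesis by (simp add: edge_word_def)
qed

lemma ghost_word_edge_word:
  assumes "awalk u q v" "awalk v t w"
  shows "mon (ghost_word q v @ edge_word (q @ t) w) \<simeq> mon (edge_word t w)"
  using assms
proof (induction q arbitrary: u)
  case Nil
  then show ?case by (auto simp: awalk_Nil_iff intro: source_edge_word)
next
  case (Cons e q)
  then have e: "e \<in> arcs G" "awalk (head G e) q v" "awalk (head G e) (q @ t) w"
    by (auto simp: awalk_Cons_iff intro: awalk_appendI)
  have "mon (ghost_word q v @ [Ghost e, Edge e] @ edge_word (q @ t) w)
      \<simeq> mon (ghost_word q v @ [Vertex (head G e)] @ edge_word (q @ t) w)"
    using e word_closed[OF e(2)] word_closed[OF e(3)] by (intro mon_context letter_cong) auto
  also have "\<dots> \<simeq> mon (ghost_word q v @ edge_word (q @ t) w)"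
    using mon_context[OF source_edge_word[OF e(3)], of "ghost_word q v" "[]"]
      word_closed[OF e(2)] by simp
  also have "\<dots> \<simeq> mon (edge_word t w)" using Cons.IH e(2) Cons.prems(2) by blast
  finally show ?case by simp
qed

text \<open>
  Cancel \<open>e* e\<close> along the common initial segment.  Either two different
  edges meet, or one of the paths is trivial and starts at another vertex than the other path.
\<close>

lemma ghost_word_edge_word_incomparable:
  assumes "awalk u q v" "awalk u' q' v'" "u = u' \<Longrightarrow> \<not> prefix q q' \<and> \<not> prefix q' q"
  shows "mon (ghost_word q v @ edge_word q' v') \<simeq> 0"
  using assms
proof (induction q arbitrary: u u' q')
  case Nil
  then have "u = v" "v \<in> verts G" "v \<noteq> u'" by (auto simp: awalk_Nil_iff)
  with Nil show ?case by (auto intro: other_source_edge_word)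
next
  case (Cons e q)
  have e: "e \<in> arcs G" "tail G e = u" "awalk (head G e) q v"
    using Cons.prems(1) by (auto simp: awalk_Cons_iff)
  show ?case
  proof (cases q')
    case Nil
    then have "u' = v'" "v' \<in> verts G" "v' \<noteq> u" using Cons.prems by (auto simp: awalk_Nil_iff)
    then show ?thesis using ghost_word_other_source[OF Cons.prems(1)] Nil by simp
  next
    case q': (Cons f q\<^sub>1)
    then have f: "f \<in> arcs G" "tail G f = u'" "awalk (head G f) q\<^sub>1 v'"
      using Cons.prems(2) by (auto simp: awalk_Cons_iff)
    show ?thesis
    proof (cases "e = f")
      case False
      have "mon (ghost_word q v @ [Ghost e, Edge f] @ edge_word q\<^sub>1 v') \<simeq> 0"
        using e f False word_closed[OF e(3)] word_closed[OF f(3)]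
        by (intro mon_context_zero letter_cong) auto
      then show ?thesis using q' by simp
    next
      case True
      have "mon (ghost_word q v @ [Ghost e, Edge e] @ edge_word q\<^sub>1 v')
          \<simeq> mon (ghost_word q v @ [Vertex (head G e)] @ edge_word q\<^sub>1 v')"
        using e word_closed[OF e(3)] word_closed[OF f(3)] by (intro mon_context letter_cong) auto
      also have "\<dots> \<simeq> mon (ghost_word q v @ edge_word q\<^sub>1 v')"
        using mon_context[OF source_edge_word[OF f(3)], of "ghost_word q v" "[]"]
          word_closed[OF e(3)] True by simp
      also have "\<dots> \<simeq> 0"
        using Cons.prems(3) e f True q' by (intro Cons.IH[OF e(3) f(3)]) auto
      finally show ?thesis using q' True by simp
    qed
  qed
qed


section \<open>Normal forms\<close>

text \<open>
  The words \<open>p q*\<close> with \<open>q\<close> of length \<open>n\<close>, or shorter and ending in a sink.  Only the lengths of the ghost paths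
  are bounded: equal ghost paths can then be separated by multiplication from the right, and
  an expansion at the range lengthens \<open>q\<close> by exactly one.
\<close>

definition normal_word :: "nat \<Rightarrow> ('v, 'e) leavitt_gen list \<Rightarrow> bool" where
  "normal_word n ws \<longleftrightarrow> (\<exists>u p v u' q. awalk u p v \<and> awalk u' q v \<and>
     ws = edge_word p v @ ghost_word q v \<and>
     (length q = n \<or> length q < n \<and> out_arcs G v = {}))"

lemma normal_wordI:
  "awalk u p v \<Longrightarrow> awalk u' q v \<Longrightarrow> length q = n \<or> length q < n \<and> out_arcs G v = {} \<Longrightarrow>
    normal_word n (edge_word p v @ ghost_word q v)"
  unfolding normal_word_def by metis

definition normal :: "nat \<Rightarrow> ('s, ('v, 'e) leavitt_gen) free_elem \<Rightarrow> bool" where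
  "normal n x \<longleftrightarrow> (\<forall>w \<in> Poly_Mapping.keys x. normal_word n (letters w))"

definition reducible :: "nat \<Rightarrow> ('s, ('v, 'e) leavitt_gen) free_elem \<Rightarrow> bool" where
  "reducible n x \<longleftrightarrow> (\<exists>x'. x \<simeq> x' \<and> normal n x')"

lemma reducible_cong: "x \<simeq> y \<Longrightarrow> reducible n y \<Longrightarrow> reducible n x"
  unfolding reducible_def using cong_trans by blast

lemma reducible_zero: "reducible n 0"
  unfolding reducible_def normal_def by (auto intro!: exI[of _ 0] cong_refl free_algebra_zero)

lemma reducible_plus: "reducible n x \<Longrightarrow> reducible n y \<Longrightarrow> reducible n (x + y)"
proof -
  assume "reducible n x" "reducible n y"
  then obtain x' y' where "x \<simeq> x'" "normal n x'" "y \<simeq> y'" "normal n y'"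
    unfolding reducible_def by blast
  then have "x + y \<simeq> x' + y'" "normal n (x' + y')"
    using keys_add[of x' y'] by (auto intro: cong_plus simp: normal_def)
  then show ?thesis unfolding reducible_def by blast
qed

lemma keys_free_scale: "w \<in> Poly_Mapping.keys (free_scale c x) \<Longrightarrow> w \<in> Poly_Mapping.keys x"
  by (auto simp: in_keys_iff lookup_free_scale)

lemma reducible_scale: "reducible n x \<Longrightarrow> reducible n (free_scale c x)"
  unfolding reducible_def normal_def
  by (blast intro: cong_scale dest: keys_free_scale)

lemma reducible_sum: "(\<And>i. i \<in> I \<Longrightarrow> reducible n (h i)) \<Longrightarrow> reducible n (sum h I)"
  by (induction I rule: infinite_finite_induct) (auto intro: reducible_zero reducible_plus)

lemma single_eq_scale: "Poly_Mapping.single w c = free_scale c (mon (letters w))"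
  by (rule poly_mapping_eqI) (simp add: lookup_free_scale lookup_single when_def)

lemma reducible_if_monomials:
  assumes "\<And>w. w \<in> Poly_Mapping.keys x \<Longrightarrow> reducible n (mon (letters w))"
  shows "reducible n x"
proof -
  have "reducible n (\<Sum>w\<in>Poly_Mapping.keys x. free_scale (Poly_Mapping.lookup x w) (mon (letters w)))"
    using assms by (intro reducible_sum reducible_scale)
  then show ?thesis by (simp only: single_eq_scale[symmetric] sum_singles)
qed

lemma normal_word_closed: "normal_word n ws \<Longrightarrow> mon ws \<in> A"
  unfolding normal_word_def by (clarify, rule mon_closed) (auto dest: word_closed)

lemma reducible_normal_word: "normal_word n ws \<Longrightarrow> reducible n (mon ws)"
  unfolding reducible_def using normal_word_closed
  by (auto intro!: exI[of _ "mon ws"] cong_refl simp: normal_def)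

text \<open>
  The relation at a regular vertex, inserted between \<open>p\<close> and \<open>q*\<close>.  Row-finiteness makes every vertex
  that emits an edge regular, so each range that is not a sink can be expanded.
\<close>

lemma expand_at_range:
  assumes p: "awalk u p v" and q: "awalk u' q v" and v: "out_arcs G v \<noteq> {}"
  shows "mon (edge_word p v @ ghost_word q v) \<simeq>
    (\<Sum>e\<in>out_arcs G v. mon (edge_word (p @ [e]) (head G e) @ ghost_word (q @ [e]) (head G e)))"
proof -
  let ?us = "edge_word p v" and ?ws = "map Ghost (rev q)"
  have closed: "set ?us \<subseteq> X" "set (map Edge p) \<subseteq> X" "set ?ws \<subseteq> X"
    using awalk_letters[OF p] awalk_letters[OF q] word_closed[OF p] by auto
  have "v \<in> verts G" using p by auto
  then have "regular_vertex G v"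
    using v row_finite by (simp add: regular_vertex_def row_finite_def)
  from relation_cong[OF leavitt_relations.regular[OF this]]
  have "mon [Vertex v] \<simeq> (\<Sum>e\<in>out_arcs G v. mon [Edge e, Ghost e])" 
    by (simp add: gen_def mult_single plus_free_word_def)
  from cong_context[OF this closed(1,3)]
  have "mon (edge_word p v @ ghost_word q v) \<simeq>
      (\<Sum>e\<in>out_arcs G v. mon (?us @ [Edge e, Ghost e] @ ?ws))"
    by (simp add: mon_append[symmetric] sum_distrib_left sum_distrib_right ghost_word_def)
  also have "\<dots> \<simeq>
      (\<Sum>e\<in>out_arcs G v. mon (edge_word (p @ [e]) (head G e) @ ghost_word (q @ [e]) (head G e)))"
  proof (rule cong_sum)
    fix e assume "e \<in> out_arcs G v"
    then have e: "e \<in> arcs G" "tail G e = v" by auto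
    have "mon (map Edge p @ [Vertex v, Edge e] @ Ghost e # ?ws)
        \<simeq> mon (map Edge p @ [Edge e] @ Ghost e # ?ws)"
      using e letter_cong(3)[of e] closed by (intro mon_context) auto
    also have "\<dots> \<simeq> mon (map Edge p @ [Edge e, Vertex (head G e)] @ Ghost e # ?ws)"
      using e closed by (intro cong_sym[OF mon_context] letter_cong) auto
    also have "\<dots> = mon ((map Edge p @ [Edge e, Vertex (head G e)]) @ [Ghost e] @ ?ws)"
      by simp
    also have "\<dots> \<simeq> mon ((map Edge p @ [Edge e, Vertex (head G e)]) @
        [Vertex (head G e), Ghost e] @ ?ws)"
      using e closed by (intro cong_sym[OF mon_context] letter_cong) auto
    finally show "mon (?us @ [Edge e, Ghost e] @ ?ws) \<simeq>
        mon (edge_word (p @ [e]) (head G e) @ ghost_word (q @ [e]) (head G e))"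
      by (simp add: edge_word_def ghost_word_def)
  qed
  finally show ?thesis .
qed

lemma reducible_normal_word_Suc:
  assumes "normal_word n ws"
  shows "reducible (Suc n) (mon ws)"
proof -
  from assms obtain u p v u' q where p: "awalk u p v" and q: "awalk u' q v"
    and ws: "ws = edge_word p v @ ghost_word q v"
    and n: "length q = n \<or> length q < n \<and> out_arcs G v = {}"
    unfolding normal_word_def by blast
  show ?thesis
  proof (cases "out_arcs G v = {}")
    case True
    then have "normal_word (Suc n) ws" unfolding ws by (intro normal_wordI[OF p q]) (use n in auto)
    then show ?thesis by (rule reducible_normal_word)
  next
    case False
    have "reducible (Suc n) (\<Sum>e\<in>out_arcs G v.
        mon (edge_word (p @ [e]) (head G e) @ ghost_word (q @ [e]) (head G e)))"
    proof (intro reducible_sum reducible_normal_word)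
      fix e assume e: "e \<in> out_arcs G v"
      then have "awalk v [e] (head G e)" by (auto simp: arc_implies_awalk)
      with p q have "awalk u (p @ [e]) (head G e)" "awalk u' (q @ [e]) (head G e)"
        by (blast intro: awalk_appendI)+
      then show "normal_word (Suc n)
          (edge_word (p @ [e]) (head G e) @ ghost_word (q @ [e]) (head G e))"
        by (rule normal_wordI) (use n False in auto)
    qed
    then show ?thesis
      unfolding ws by (rule reducible_cong[OF expand_at_range[OF p q False]])
  qed
qed

lemma reducible_Suc: "reducible n x \<Longrightarrow> reducible (Suc n) x"
proof -
  assume "reducible n x"
  then obtain x' where x': "x \<simeq> x'" "normal n x'" unfolding reducible_def by blast
  then have "reducible (Suc n) x'"
    by (auto intro!: reducible_if_monomials[of x'] reducible_normal_word_Suc simp: normal_def)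
  with x'(1) show ?thesis by (rule reducible_cong)
qed

lemma reducible_mono: "n \<le> m \<Longrightarrow> reducible n x \<Longrightarrow> reducible m x"
  by (induction m rule: dec_induct) (auto intro: reducible_Suc)

text \<open>
  The words \<open>p q*\<close> and zero absorb all generators from the left.  A ghost edge
  cancels the first edge of \<open>p\<close>, or is zero, or extends \<open>q\<close> if \<open>p\<close> is trivial; in the last case the
  length of \<open>q\<close> changes, so nothing is claimed about \<open>m\<close>.
\<close>

lemma letter_times_normal_word:
  assumes g: "g \<in> X" and ws: "normal_word n ws"
  shows "mon (g # ws) \<simeq> 0 \<or> (\<exists>m ws'. mon (g # ws) \<simeq> mon ws' \<and> normal_word m ws')"
proof -
  from ws obtain u p v u' q where p: "awalk u p v" and q: "awalk u' q v"
    and ws: "ws = edge_word p v @ ghost_word q v"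
    unfolding normal_word_def by blast
  note closed = word_closed[OF p] word_closed[OF q]
  have normal: "\<exists>m. normal_word m (edge_word p' v' @ ghost_word q' v')"
    if "awalk w p' v'" "awalk w' q' v'" for w p' v' w' q'
    using normal_wordI[OF that] by blast
  have normalised: ?thesis if "mon (g # ws) \<simeq> mon (edge_word p' v' @ ghost_word q' v')"
    "awalk w p' v'" "awalk w' q' v'" for w p' v' w' q'
    using normal[OF that(2,3)] that(1) by blast
  have vertex: "mon (Vertex w # ws) \<simeq> mon ws" if "w = u" for w
    using mon_context[OF source_edge_word[OF p], of "[]" "ghost_word q v"] closed that ws by simp
  have vertex_zero: "mon (Vertex w # ws) \<simeq> 0" if "w \<noteq> u" "w \<in> verts G" for w
    using mon_context_zero[OF other_source_edge_word[OF p], of w "[]" "ghost_word q v"]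
      closed that ws by simp
  from g consider w where "g = Vertex w" "w \<in> verts G" | e where "g = Edge e" "e \<in> arcs G"
    | e where "g = Ghost e" "e \<in> arcs G" by (auto simp: leavitt_generators_def)
  then show ?thesis
  proof cases
    case 1
    then show ?thesis using vertex vertex_zero normalised[OF _ p q] ws by (cases "w = u") auto
  next
    case 2
    show ?thesis
    proof (cases "head G e = u")
      case True
      then have "awalk (tail G e) (e # p) v" using 2 p by (auto simp: awalk_Cons_iff)
      moreover have "mon (g # ws) \<in> A" using 2 closed ws by (intro mon_closed) auto
      ultimately show ?thesis using normalised[OF _ _ q, of "e # p"] 2 ws by (auto intro: cong_refl)
    next
      case False
      have "mon ([Edge e, Vertex (head G e)] @ ws) \<simeq> mon ([Edge e] @ ws)"
        using mon_context[OF letter_cong(4), of e "[]" ws] 2 closed ws by auto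
      moreover have "mon ([Edge e] @ (Vertex (head G e) # ws) @ []) \<simeq> 0"
        using False 2 by (intro mon_context_zero vertex_zero) auto
      ultimately show ?thesis using 2 by (auto intro: cong_trans cong_sym)
    qed
  next
    case 3
    show ?thesis
    proof (cases "tail G e = u")
      case False
      have "mon ([Ghost e, Vertex (tail G e)] @ ws) \<simeq> mon ([Ghost e] @ ws)"
        using mon_context[OF letter_cong(6), of e "[]" ws] 3 closed ws by auto
      moreover have "mon ([Ghost e] @ (Vertex (tail G e) # ws) @ []) \<simeq> 0"
        using False 3 by (intro mon_context_zero vertex_zero) auto
      ultimately show ?thesis using 3 by (auto intro: cong_trans cong_sym)
    next
      case True
      show ?thesis
      proof (cases p)
        case Nil
        let ?gs = "map Ghost (rev q)"
        have gs: "set ?gs \<subseteq> X" using awalk_letters[OF q] by auto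
        have v: "v = u" "v \<in> verts G" using p Nil by (auto simp: awalk_Nil_iff)
        have "mon (g # ws) = mon ([] @ [Ghost e, Vertex v] @ Vertex v # ?gs)"
          using ws Nil 3 by (simp add: ghost_word_def)
        also have "\<dots> \<simeq> mon ([] @ [Ghost e] @ Vertex v # ?gs)"
          using v gs True 3 letter_cong(6)[of e] by (intro mon_context) auto
        also have "\<dots> = mon ([] @ [Ghost e, Vertex v] @ ?gs)" by simp
        also have "\<dots> \<simeq> mon ([] @ [Ghost e] @ ?gs)"
          using v gs True 3 letter_cong(6)[of e] by (intro mon_context) auto
        also have "\<dots> \<simeq> mon ([] @ [Vertex (head G e), Ghost e] @ ?gs)"
          using gs 3 by (intro cong_sym[OF mon_context] letter_cong) auto
        also have "\<dots> = mon ([Vertex (head G e)] @ [Ghost e] @ ?gs)" by simp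
        also have "\<dots> \<simeq> mon ([Vertex (head G e)] @ [Vertex (head G e), Ghost e] @ ?gs)"
          using gs 3 by (intro cong_sym[OF mon_context] letter_cong) auto
        also have "\<dots> = mon (edge_word [] (head G e) @ ghost_word (q @ [e]) (head G e))"
          by (simp add: ghost_word_def)
        finally show ?thesis
        proof (rule normalised)
          show "awalk (head G e) [] (head G e)" using 3 by (simp add: awalk_Nil_iff)
          show "awalk u' (q @ [e]) (head G e)"
            using q v True 3 by (auto intro!: awalk_appendI arc_implies_awalk)
        qed
      next
        case (Cons f p')
        then have f: "f \<in> arcs G" "tail G f = u" "awalk (head G f) p' v"
          using p by (auto simp: awalk_Cons_iff)
        have rest: "set (edge_word p' v @ ghost_word q v) \<subseteq> X"
          using word_closed[OF f(3)] closed by auto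
        show ?thesis
        proof (cases "e = f")
          case False
          have "mon ([] @ [Ghost e, Edge f] @ edge_word p' v @ ghost_word q v) \<simeq> 0"
            using 3 f rest False by (intro mon_context_zero letter_cong) auto
          then show ?thesis using 3 ws Cons by simp
        next
          case True
          have "mon ([] @ [Ghost e, Edge e] @ edge_word p' v @ ghost_word q v) \<simeq>
              mon ([] @ [Vertex (head G e)] @ edge_word p' v @ ghost_word q v)"
            using 3 rest by (intro mon_context letter_cong) auto
          also have "\<dots> \<simeq> mon (edge_word p' v @ ghost_word q v)"
            using mon_context[OF source_edge_word[OF f(3)], of "[]" "ghost_word q v"] closed True
            by simp
          finally show ?thesis using normalised[OF _ f(3) q] 3 ws Cons True by simp
        qed
      qed
    qed
  qed
qed

lemma letter_range:
  assumes "g \<in> X"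
  shows "\<exists>w \<in> verts G. mon [g] \<simeq> mon [g, Vertex w]"
proof -
  from assms consider w where "g = Vertex w" "w \<in> verts G" | e where "g = Edge e" "e \<in> arcs G"
    | e where "g = Ghost e" "e \<in> arcs G" by (auto simp: leavitt_generators_def)
  then show ?thesis
  proof cases
    case 1
    with letter_cong(1)[of w] show ?thesis by (intro bexI[of _ w]) (simp_all add: cong_sym)
  next
    case 2
    with letter_cong(4)[of e] show ?thesis
      by (intro bexI[of _ "head G e"]) (simp_all add: cong_sym)
  next
    case 3
    with letter_cong(6)[of e] show ?thesis
      by (intro bexI[of _ "tail G e"]) (simp_all add: cong_sym)
  qed
qed

lemma word_reduces:
  assumes "ws \<noteq> []" "set ws \<subseteq> X"
  shows "mon ws \<simeq> 0 \<or> (\<exists>m ws'. mon ws \<simeq> mon ws' \<and> normal_word m ws')"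
  using assms
proof (induction ws rule: list_nonempty_induct)
  case (single g)
  obtain w where w: "w \<in> verts G" "mon [g] \<simeq> mon [g, Vertex w]"
    using letter_range[of g] single by auto
  have "mon ([g] @ [Vertex w] @ []) \<simeq> mon ([g] @ [Vertex w, Vertex w] @ [])"
    using single w by (intro cong_sym[OF mon_context] letter_cong) auto
  with w(2) have red: "mon [g] \<simeq> mon (g # [Vertex w, Vertex w])"
    by (auto intro: cong_trans)
  have "normal_word 0 [Vertex w, Vertex w]"
    using normal_wordI[of w "[]" w w "[]" 0] w(1) by (simp add: awalk_Nil_iff)
  then have "mon (g # [Vertex w, Vertex w]) \<simeq> 0 \<or>
      (\<exists>m ws'. mon (g # [Vertex w, Vertex w]) \<simeq> mon ws' \<and> normal_word m ws')"
    using single by (intro letter_times_normal_word) auto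
  then show ?case using cong_trans[OF red] by blast
next
  case (cons g ws)
  then have g: "g \<in> X" and ws: "set ws \<subseteq> X" by auto
  from cons.IH[OF ws] consider "mon ws \<simeq> 0" | m ws' where "mon ws \<simeq> mon ws'" "normal_word m ws'"
    by blast
  then show ?case
  proof cases
    case 1
    from mon_context_zero[OF this, of "[g]" "[]"] g show ?thesis by simp
  next
    case 2
    from mon_context[OF 2(1), of "[g]" "[]"] g have "mon (g # ws) \<simeq> mon (g # ws')" by simp
    with letter_times_normal_word[OF g 2(2)] show ?thesis by (blast intro: cong_trans)
  qed
qed

lemma eventually_reducible:
  assumes "x \<in> A"
  shows "\<exists>n. reducible n x"
proof -
  have "\<exists>n. reducible n (mon (letters w))" if "w \<in> Poly_Mapping.keys x" for w
  proof -
    have "letters w \<noteq> []" "set (letters w) \<subseteq> X" using assms that by (auto simp: free_algebra_def)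
    from word_reduces[OF this] show ?thesis
      using reducible_cong reducible_zero reducible_normal_word by blast
  qed
  then obtain N where N: "\<And>w. w \<in> Poly_Mapping.keys x \<Longrightarrow> reducible (N w) (mon (letters w))"
    by metis
  have "reducible (Max (N ` Poly_Mapping.keys x)) x"
  proof (rule reducible_if_monomials)
    fix w assume w: "w \<in> Poly_Mapping.keys x"
    then have "N w \<le> Max (N ` Poly_Mapping.keys x)" by (intro Max_ge) auto
    then show "reducible (Max (N ` Poly_Mapping.keys x)) (mon (letters w))"
      using N[OF w] by (rule reducible_mono)
  qed
  then show ?thesis ..
qed

end


section \<open>Paths that avoid given closed paths\<close>

context wf_digraph
begin

lemma closed_walk_has_exit:
  assumes exits: "\<And>c. cycle c \<Longrightarrow> \<exists>f. is_exit G f c"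
    and t: "awalk v t v" "t \<noteq> []"
  shows "\<exists>g \<in> set t. \<exists>f \<in> arcs G. tail G f = tail G g \<and> f \<noteq> g"
  using t
proof (induction "length t" arbitrary: v t rule: less_induct)
  case less
  show ?case
  proof (cases "distinct (map (tail G) t)")
    case True
    with less.prems have "cycle t" unfolding cycle_iff_distinct_sources by blast
    from exits[OF this] show ?thesis unfolding is_exit_def by (metis nth_mem)
  next
    case False
    then obtain xs y ys zs where "map (tail G) t = xs @ [y] @ ys @ [y] @ zs"
      using not_distinct_decomp by blast
    then obtain a g b g' c where t: "t = a @ (g # b) @ (g' # c)"
      and y: "tail G g = y" "tail G g' = y"
      by (auto simp: map_eq_append_conv map_eq_Cons_conv append_eq_map_conv Cons_eq_map_conv)
    have "awalk y (g # b) y"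
      using less.prems(1) y unfolding t awalk_append_iff by (auto simp: awalk_Cons_iff)
    from less.hyps[OF _ this] show ?thesis unfolding t by auto
  qed
qed

text \<open>
  Follow \<open>t\<close> up to an exit and leave it there.
\<close>

lemma path_leaving_closed_walk:
  assumes exits: "\<And>c. cycle c \<Longrightarrow> \<exists>f. is_exit G f c"
    and t: "awalk v t v" "t \<noteq> []"
  shows "\<exists>z u. awalk v z u \<and> \<not> prefix z (t @ z)"
proof -
  obtain g f where g: "g \<in> set t" and f: "f \<in> arcs G" "tail G f = tail G g" "f \<noteq> g"
    using closed_walk_has_exit[OF assms] by blast
  then obtain t\<^sub>1 t\<^sub>2 where t12: "t = t\<^sub>1 @ g # t\<^sub>2" by (auto simp: in_set_conv_decomp)
  have "awalk v (t\<^sub>1 @ [f]) (head G f)"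
    using t(1) f unfolding t12 awalk_append_iff by (auto simp: awalk_Cons_iff awalk_Nil_iff)
  moreover have "\<not> prefix (t\<^sub>1 @ [f]) (t @ t\<^sub>1 @ [f])" using f(3) t12 by simp
  ultimately show ?thesis by blast
qed

lemma awalk_power: "awalk v t v \<Longrightarrow> awalk v (concat (replicate n t)) v"
  by (induction n) (auto simp: awalk_Nil_iff intro: awalk_appendI)

text \<open>
  A path \<open>z\<close> that is an initial segment of \<open>t z\<close> is an initial segment of all powers of \<open>t\<close>.  One closed walk is
  added at a time: if \<open>z\<close> runs along the powers of the new walk \<open>t\<close>, continue along \<open>t\<close> and then leave it.
  Extending \<open>z\<close> does not destroy what it avoids already.
\<close>

lemma path_avoiding_closed_walks:
  assumes exits: "\<And>c. cycle c \<Longrightarrow> \<exists>f. is_exit G f c"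
    and v: "v \<in> verts G"
    and "finite T" "\<And>t. t \<in> T \<Longrightarrow> awalk v t v \<and> t \<noteq> []"
  shows "\<exists>z u. awalk v z u \<and> (\<forall>t \<in> T. \<not> prefix z (t @ z))"
  using assms(3,4)
proof (induction T rule: finite_induct)
  case empty
  show ?case using v by (intro exI[of _ "[]"] exI[of _ v]) (simp add: awalk_Nil_iff)
next
  case (insert t T)
  then obtain z u where z: "awalk v z u" "\<forall>s \<in> T. \<not> prefix z (s @ z)" by blast
  have t: "awalk v t v" "t \<noteq> []" using insert.prems by auto
  show ?case
  proof (cases "prefix z (t @ z)")
    case False
    with z show ?thesis by blast
  next
    case True
    obtain z' u' where z': "awalk v z' u'" "\<not> prefix z' (t @ z')"
      using path_leaving_closed_walk[OF exits t] by blast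
    \<comment> \<open>Each copy of \<open>t\<close> has at least one edge, so \<open>length z\<close> copies cover \<open>z\<close>.\<close>
    define tn where "tn = concat (replicate (length z) t)"
    have "prefix z (concat (replicate n t) @ z)" for n
    proof (induction n)
      case (Suc n)
      then have "prefix (t @ z) (t @ concat (replicate n t) @ z)" by simp
      with True show ?case using prefix_order.trans by fastforce
    qed simp
    then have "prefix z (tn @ z)" by (simp add: tn_def)
    moreover have "length z \<le> length tn"
      using t(2) by (simp add: tn_def length_concat sum_list_replicate Suc_leI)
    ultimately have z_tn: "prefix z tn" using prefix_length_prefix[of z "tn @ z" tn] by simp
    have "t @ concat (replicate n t) = concat (replicate n t) @ t" for n
      by (induction n) auto
    then have comm: "t @ tn = tn @ t" by (simp add: tn_def)
    have "awalk v (tn @ z') u'"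
      unfolding tn_def using awalk_power[OF t(1)] z'(1) by (rule awalk_appendI)
    moreover have "\<not> prefix (tn @ z') (s @ tn @ z')" if s: "s \<in> insert t T" for s
    proof (cases "s = t")
      case True
      have "t @ tn @ z' = tn @ t @ z'" using comm by (metis append_assoc)
      with z'(2) show ?thesis unfolding True by (simp only: same_prefix_prefix not_False_eq_True)
    next
      case False
      show ?thesis
      proof
        assume "prefix (tn @ z') (s @ tn @ z')"
        then have "prefix z (s @ tn @ z')"
          using z_tn by (meson prefix_order.trans prefixI)
        moreover have "prefix (s @ z) (s @ tn @ z')" using z_tn by (simp add: prefix_prefix)
        ultimately have "prefix z (s @ z)" by (rule prefix_length_prefix) simp
        with z(2) s False show False by blast
      qed
    qed
    ultimately show ?thesis by blast
  qed
qed

end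


section \<open>Isolating a coefficient\<close>

context leavitt_calculus
begin

text \<open>
  Applied to the word of \<open>p q*\<close> it returns \<open>p\<close>; the closed paths that have to be avoided can thus be
  read off from words.
\<close>

fun edges_of :: "('v, 'e) leavitt_gen list \<Rightarrow> 'e list" where
  "edges_of [] = []"
| "edges_of (Edge e # ws) = e # edges_of ws"
| "edges_of (_ # ws) = edges_of ws"

lemma edges_of_word: "edges_of (edge_word p v @ ghost_word q v) = p"
proof (induction p)
  case Nil
  have "edges_of (map Ghost q) = []" for q :: "'e list" by (induction q) auto
  then show ?case by (simp add: ghost_word_def)
qed simp

text \<open>
  A path that continues beyond another one cannot do so from a sink, and otherwise exceeds length \<open>n\<close>.
\<close>

lemma normal_paths_comparable:
  assumes "awalk a q v" "awalk a r w" "prefix q r \<or> prefix r q"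
    and "length q = n \<or> length q < n \<and> out_arcs G v = {}"
    and "length r = n \<or> length r < n \<and> out_arcs G w = {}"
  shows "q = r \<and> v = w"
proof -
  have *: "q = r \<and> v = w"
    if "awalk a q v" "awalk a r w" "prefix q r"
      "length q = n \<or> length q < n \<and> out_arcs G v = {}" "length r \<le> n" for q r v w
  proof -
    from that(3) obtain s where s: "r = q @ s" by (auto simp: prefix_def)
    with that(1,2) have s': "awalk v s w" by (simp add: awalk_append_iff)
    have "s = []"
    proof (cases s)
      case (Cons e s')
      with s' have "e \<in> out_arcs G v" by (auto simp: awalk_Cons_iff)
      with that(4,5) s Cons show ?thesis by auto
    qed
    with s s' show ?thesis by (auto simp: awalk_Nil_iff)
  qed
  show ?thesis using assms * by (metis le_eq_less_or_eq)
qed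

text \<open>
  In \<open>z* p\<^sub>0* p q* q\<^sub>0 z\<close> the factor \<open>q* q\<^sub>0\<close> forces \<open>q = q\<^sub>0\<close>.  Incomparable \<open>p\<close> and \<open>p\<^sub>0\<close> also give
  zero.  If they are comparable and distinct, one is the other followed by a nontrivial closed path
  \<open>t\<close>, and what remains is \<open>z* t z\<close> or its image under the involution; both are zero by the choice of \<open>z\<close>.
\<close>

lemma isolate_word:
  assumes p\<^sub>0: "awalk a\<^sub>0 p\<^sub>0 v\<^sub>0" and q\<^sub>0: "awalk b\<^sub>0 q\<^sub>0 v\<^sub>0"
    and n\<^sub>0: "length q\<^sub>0 = n \<or> length q\<^sub>0 < n \<and> out_arcs G v\<^sub>0 = {}"
    and z: "awalk v\<^sub>0 z u"
    and ws: "normal_word n ws"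
    and avoid: "\<And>t. t \<noteq> [] \<Longrightarrow> awalk v\<^sub>0 t v\<^sub>0 \<Longrightarrow> suffix t p\<^sub>0 \<or> suffix t (edges_of ws) \<Longrightarrow>
      \<not> prefix z (t @ z)"
  shows "mon (ghost_word (p\<^sub>0 @ z) u) * mon ws * mon (edge_word (q\<^sub>0 @ z) u) \<simeq>
    (if ws = edge_word p\<^sub>0 v\<^sub>0 @ ghost_word q\<^sub>0 v\<^sub>0 then mon [Vertex u] else 0)"
proof -
  from ws obtain a p v b q where p: "awalk a p v" and q: "awalk b q v"
    and ws_eq: "ws = edge_word p v @ ghost_word q v"
    and n: "length q = n \<or> length q < n \<and> out_arcs G v = {}"
    unfolding normal_word_def by blast
  have edges: "edges_of ws = p" unfolding ws_eq by (rule edges_of_word)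
  have p\<^sub>0z: "awalk a\<^sub>0 (p\<^sub>0 @ z) u" and q\<^sub>0z: "awalk b\<^sub>0 (q\<^sub>0 @ z) u"
    using p\<^sub>0 q\<^sub>0 z by (blast intro: awalk_appendI)+
  note closed = word_closed[OF p] word_closed[OF q] word_closed[OF p\<^sub>0z] word_closed[OF q\<^sub>0z]
    word_closed[OF z]
  let ?left = "ghost_word (p\<^sub>0 @ z) u"
  have product: "mon ?left * mon ws * mon (edge_word (q\<^sub>0 @ z) u) =
      mon ((?left @ edge_word p v) @ (ghost_word q v @ edge_word (q\<^sub>0 @ z) u) @ [])"
    by (simp add: ws_eq mon_append[symmetric])
  show ?thesis
  proof (cases "q = q\<^sub>0 \<and> v = v\<^sub>0")
    case False
    have "mon (ghost_word q v @ edge_word (q\<^sub>0 @ z) u) \<simeq> 0"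
    proof (rule ghost_word_edge_word_incomparable[OF q q\<^sub>0z])
      assume b: "b = b\<^sub>0"
      have "\<not> (prefix q q\<^sub>0 \<or> prefix q\<^sub>0 q)"
        using normal_paths_comparable[OF q[unfolded b] q\<^sub>0 _ n n\<^sub>0] False by blast
      then show "\<not> prefix q (q\<^sub>0 @ z) \<and> \<not> prefix (q\<^sub>0 @ z) q"
        by (metis append_prefixD prefixI prefix_same_cases)
    qed
    then have "mon ((?left @ edge_word p v) @
        (ghost_word q v @ edge_word (q\<^sub>0 @ z) u) @ []) \<simeq> 0"
      by (rule mon_context_zero) (use closed in auto)
    moreover have "ws \<noteq> edge_word p\<^sub>0 v\<^sub>0 @ ghost_word q\<^sub>0 v\<^sub>0"
    proof
      assume "ws = edge_word p\<^sub>0 v\<^sub>0 @ ghost_word q\<^sub>0 v\<^sub>0"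
      moreover from this have "p = p\<^sub>0" using edges edges_of_word by metis
      ultimately have "v = v\<^sub>0" "map Ghost (rev q) = (map Ghost (rev q\<^sub>0) :: ('v, 'e) leavitt_gen list)"
        unfolding ws_eq by (simp_all add: edge_word_def ghost_word_def)
      then have "q = q\<^sub>0" by (simp add: inj_map_eq_map inj_on_def)
      with False \<open>v = v\<^sub>0\<close> show False by simp
    qed
    ultimately show ?thesis using product by simp
  next
    case True
    have "mon (ghost_word q v @ edge_word (q\<^sub>0 @ z) u) \<simeq> mon (edge_word z u)"
      using ghost_word_edge_word[OF q, of z u] z True by simp
    from mon_context[OF this, of "?left @ edge_word p v" "[]"] closed
    have "mon ?left * mon ws * mon (edge_word (q\<^sub>0 @ z) u) \<simeq>
        mon (?left @ (edge_word p v @ edge_word z u) @ [])" unfolding product by simp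
    also have "\<dots> \<simeq> mon (?left @ edge_word (p @ z) u @ [])"
      using closed edge_word_append[OF p] z True by (intro mon_context) auto
    finally have reduced: "mon ?left * mon ws * mon (edge_word (q\<^sub>0 @ z) u) \<simeq>
        mon (?left @ edge_word (p @ z) u)" by simp
    have pz: "awalk a (p @ z) u" using p z True by (blast intro: awalk_appendI)
    show ?thesis
    proof (cases "p = p\<^sub>0")
      case p_eq: True
      have "mon (?left @ edge_word ((p\<^sub>0 @ z) @ []) u) \<simeq> mon (edge_word [] u)"
        using p\<^sub>0z by (intro ghost_word_edge_word) (auto simp: awalk_Nil_iff)
      with reduced p_eq True show ?thesis by (auto simp: ws_eq intro: cong_trans)
    next
      case p_neq: False
      have "mon (?left @ edge_word (p @ z) u) \<simeq> 0"
      proof (rule ghost_word_edge_word_incomparable[OF p\<^sub>0z pz])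
        assume a: "a\<^sub>0 = a"
        have "\<not> prefix (x @ z) (y @ z) \<and> \<not> prefix (y @ z) (x @ z)"
          if xy: "prefix x y" "awalk a x v" "awalk a y v" "x \<noteq> y" "y = p\<^sub>0 \<or> y = p" for x y
        proof -
          from xy obtain s where s: "y = x @ s" "s \<noteq> []" by (auto simp: prefix_def)
          with xy have "awalk v s v" by (simp add: awalk_append_iff)
          moreover have "suffix s p\<^sub>0 \<or> suffix s (edges_of ws)"
            using xy(5) unfolding edges s(1) by (auto intro: suffixI)
          ultimately have "\<not> prefix z (s @ z)" using avoid[OF s(2)] True by blast
          moreover have "\<not> prefix (s @ z) z" using s(2) prefix_length_le by fastforce
          ultimately show ?thesis using s(1) by simp
        qed
        from this[of p p\<^sub>0] this[of p\<^sub>0 p]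
        have "\<not> prefix (p\<^sub>0 @ z) (p @ z) \<and> \<not> prefix (p @ z) (p\<^sub>0 @ z)"
          if "prefix p p\<^sub>0 \<or> prefix p\<^sub>0 p"
          using that p p\<^sub>0 a True p_neq by auto
        then show "\<not> prefix (p\<^sub>0 @ z) (p @ z) \<and> \<not> prefix (p @ z) (p\<^sub>0 @ z)"
          by (metis append_prefixD prefixI prefix_same_cases)
      qed
      with reduced have "mon ?left * mon ws * mon (edge_word (q\<^sub>0 @ z) u) \<simeq> 0" by (rule cong_trans)
      moreover have "ws \<noteq> edge_word p\<^sub>0 v\<^sub>0 @ ghost_word q\<^sub>0 v\<^sub>0"
        using p_neq edges edges_of_word by metis
      ultimately show ?thesis by simp
    qed
  qed
qed

text \<open>
  Finitely many elements have only finitely many closed paths to avoid, because these are suffixes of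
  \<open>p\<^sub>0\<close> or of the paths that occur in the elements.
\<close>

lemma isolate_coefficient:
  assumes exits: "\<And>c. cycle c \<Longrightarrow> \<exists>f. is_exit G f c"
    and "finite N" and normal: "\<And>x. x \<in> N \<Longrightarrow> normal n x" and w\<^sub>0: "normal_word n (letters w\<^sub>0)"
  shows "\<exists>P Q u. P \<in> A \<and> Q \<in> A \<and> u \<in> verts G \<and> (\<forall>x \<in> N. 
    P * x * Q \<simeq> Poly_Mapping.single (Free_Word [Vertex u]) (Poly_Mapping.lookup x w\<^sub>0))"
proof -
  from w\<^sub>0 obtain a\<^sub>0 p\<^sub>0 v\<^sub>0 b\<^sub>0 q\<^sub>0 where p\<^sub>0: "awalk a\<^sub>0 p\<^sub>0 v\<^sub>0" and q\<^sub>0: "awalk b\<^sub>0 q\<^sub>0 v\<^sub>0"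
    and w\<^sub>0_eq: "letters w\<^sub>0 = edge_word p\<^sub>0 v\<^sub>0 @ ghost_word q\<^sub>0 v\<^sub>0"
    and n\<^sub>0: "length q\<^sub>0 = n \<or> length q\<^sub>0 < n \<and> out_arcs G v\<^sub>0 = {}"
    unfolding normal_word_def by blast
  define K where "K = (\<Union>x\<in>N. Poly_Mapping.keys x)"
  define T where "T = {t. t \<noteq> [] \<and> awalk v\<^sub>0 t v\<^sub>0 \<and>
    (suffix t p\<^sub>0 \<or> (\<exists>w \<in> K. suffix t (edges_of (letters w))))}"
  have "T \<subseteq> set (suffixes p\<^sub>0) \<union> (\<Union>w\<in>K. set (suffixes (edges_of (letters w))))"
    by (auto simp: T_def)
  moreover have "finite (set (suffixes p\<^sub>0) \<union> (\<Union>w\<in>K. set (suffixes (edges_of (letters w)))))"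
    using \<open>finite N\<close> by (simp add: K_def)
  ultimately have "finite T" by (rule finite_subset)
  have "v\<^sub>0 \<in> verts G" using p\<^sub>0 by auto
  have T_closed: "awalk v\<^sub>0 t v\<^sub>0 \<and> t \<noteq> []" if "t \<in> T" for t using that by (simp add: T_def)
  obtain z u where z: "awalk v\<^sub>0 z u" "\<forall>t \<in> T. \<not> prefix z (t @ z)"
    using path_avoiding_closed_walks[OF exits \<open>v\<^sub>0 \<in> verts G\<close> \<open>finite T\<close> T_closed] by blast
  let ?P = "mon (ghost_word (p\<^sub>0 @ z) u)" and ?Q = "mon (edge_word (q\<^sub>0 @ z) u)"
  have walks: "awalk a\<^sub>0 (p\<^sub>0 @ z) u" "awalk b\<^sub>0 (q\<^sub>0 @ z) u"
    using p\<^sub>0 q\<^sub>0 z(1) by (blast intro: awalk_appendI)+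
  have "?P \<in> A" "?Q \<in> A"
    using word_closed[OF walks(1)] word_closed[OF walks(2)]
    by (auto intro!: mon_closed)
  moreover have "u \<in> verts G" using z(1) by auto
  moreover have "?P * x * ?Q \<simeq>
    Poly_Mapping.single (Free_Word [Vertex u]) (Poly_Mapping.lookup x w\<^sub>0)" if x: "x \<in> N" for x
  proof -
    have scale: "?P * free_scale c m * ?Q = free_scale c (?P * m * ?Q)" for c m
      unfolding free_scale_mult_right by (simp add: free_scale_conv_mult mult.assoc)
    have "?P * x * ?Q = ?P * (\<Sum>w\<in>Poly_Mapping.keys x.
        free_scale (Poly_Mapping.lookup x w) (mon (letters w))) * ?Q"
      by (simp only: single_eq_scale[symmetric] sum_singles)
    also have "\<dots> = (\<Sum>w\<in>Poly_Mapping.keys x.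
        free_scale (Poly_Mapping.lookup x w) (?P * mon (letters w) * ?Q))"
      by (simp only: sum_distrib_left sum_distrib_right scale)
    also have "\<dots> \<simeq> (\<Sum>w\<in>Poly_Mapping.keys x. free_scale (Poly_Mapping.lookup x w)
        (if letters w = letters w\<^sub>0 then mon [Vertex u] else 0))"
    proof (intro cong_sum cong_scale)
      fix w assume w: "w \<in> Poly_Mapping.keys x"
      then have "w \<in> K" using x by (auto simp: K_def)
      then have "\<not> prefix z (t @ z)" if "t \<noteq> []" "awalk v\<^sub>0 t v\<^sub>0"
        "suffix t p\<^sub>0 \<or> suffix t (edges_of (letters w))" for t
        using that z(2) by (auto simp: T_def)
      then show "?P * mon (letters w) * ?Q \<simeq>
          (if letters w = letters w\<^sub>0 then mon [Vertex u] else 0)"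
        unfolding w\<^sub>0_eq using normal[OF x] w
        by (intro isolate_word[OF p\<^sub>0 q\<^sub>0 n\<^sub>0 z(1)]) (auto simp: normal_def)
    qed
    also have "\<dots> = (\<Sum>w\<in>Poly_Mapping.keys x. if w = w\<^sub>0 then
        Poly_Mapping.single (Free_Word [Vertex u]) (Poly_Mapping.lookup x w) else 0)"
    proof (rule sum.cong)
      fix w
      have "letters w = letters w\<^sub>0 \<longleftrightarrow> w = w\<^sub>0" using free_word.expand by blast
      moreover have "free_scale c (mon [Vertex u]) = Poly_Mapping.single (Free_Word [Vertex u]) c" for c
        using single_eq_scale[of "Free_Word [Vertex u]" c] by (simp only: free_word.sel)
      moreover have "free_scale c 0 = (0 :: ('s, ('v, 'e) leavitt_gen) free_elem)" for c
        by (simp add: free_scale_conv_mult)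
      ultimately show "free_scale (Poly_Mapping.lookup x w)
          (if letters w = letters w\<^sub>0 then mon [Vertex u] else 0) =
        (if w = w\<^sub>0 then Poly_Mapping.single (Free_Word [Vertex u]) (Poly_Mapping.lookup x w) else 0)"
        by simp
    qed simp
    also have "\<dots> = Poly_Mapping.single (Free_Word [Vertex u]) (Poly_Mapping.lookup x w\<^sub>0)"
      by (simp add: in_keys_iff)
    finally show ?thesis .
  qed
  ultimately show ?thesis by blast
qed

end


section \<open>Congruences of Leavitt path algebras\<close>

text \<open>
  A congruence of the Leavitt path algebra is pulled back to the free algebra, where it contains the
  defining congruence; the two kinds of steps can then be mixed in one calculation.
\<close>

locale leavitt_congruence = leavitt_calculus G S
  for G :: "('v, 'e) pre_digraph" and S :: "'s::comm_semiring_1 itself" +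
  fixes \<rho> :: "(('s, ('v, 'e) leavitt_gen) free_elem set \<times> ('s, ('v, 'e) leavitt_gen) free_elem set) set"
  assumes congruence: "hemiring_congruence (leavitt_path_algebra TYPE('s) G) \<rho>"
begin

definition cls :: "('s, ('v, 'e) leavitt_gen) free_elem \<Rightarrow> ('s, ('v, 'e) leavitt_gen) free_elem set"
  where "cls p = generated_congruence X (leavitt_relations G) `` {p}"

definition related :: "('s, ('v, 'e) leavitt_gen) free_elem \<Rightarrow>
    ('s, ('v, 'e) leavitt_gen) free_elem \<Rightarrow> bool" (infix "\<approx>" 50) where
  "p \<approx> q \<longleftrightarrow> p \<in> A \<and> q \<in> A \<and> (cls p, cls q) \<in> \<rho>"

lemma carrier: "hcarrier (leavitt_path_algebra TYPE('s) G) = cls ` A"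
  by (auto simp: leavitt_path_algebra_def presented_algebra_def Let_def quotient_def cls_def)

lemma equiv_rho: "equiv (cls ` A) \<rho>"
  using congruence unfolding hemiring_congruence_def carrier by blast

lemma rho_subset: "\<rho> \<subseteq> (cls ` A) \<times> (cls ` A)"
  using equiv_rho by (rule equiv_type)

lemma rho_refl: "p \<in> A \<Longrightarrow> (cls p, cls p) \<in> \<rho>"
  using equiv_rho by (auto elim!: equivE dest: refl_onD)

lemma cls_eq_iff: "p \<in> A \<Longrightarrow> q \<in> A \<Longrightarrow> cls p = cls q \<longleftrightarrow> p \<simeq> q"
  unfolding cls_def cong_def by (rule eq_equiv_class_iff[OF equiv_generated_congruence])

lemma related_closed: "p \<approx> q \<Longrightarrow> p \<in> A" "p \<approx> q \<Longrightarrow> q \<in> A"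
  by (auto simp: related_def)

lemma related_if_cong: "p \<simeq> q \<Longrightarrow> p \<approx> q"
  using cong_closed[of p q] cls_eq_iff[of p q] rho_refl[of q] by (simp add: related_def)

lemma related_sym: "p \<approx> q \<Longrightarrow> q \<approx> p"
  using equiv_rho by (auto simp: related_def equiv_def dest: symD)

lemma related_trans [trans]: "p \<approx> q \<Longrightarrow> q \<approx> r \<Longrightarrow> p \<approx> r"
  using equiv_rho unfolding related_def equiv_def by (blast dest: transD)

lemma cong_related_trans [trans]: "p \<simeq> q \<Longrightarrow> q \<approx> r \<Longrightarrow> p \<approx> r"
  by (rule related_trans[OF related_if_cong])

lemma related_ops:
  assumes "p \<approx> q" "r \<in> A"
  shows "r + p \<approx> r + q" "r * p \<approx> r * q" "p * r \<approx> q * r"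
proof -
  have "cls r \<in> hcarrier (leavitt_path_algebra TYPE('s) G)" "(cls p, cls q) \<in> \<rho>"
    and closed: "p \<in> A" "q \<in> A"
    using assms carrier by (auto simp: related_def)
  with congruence have
    "(hplus (leavitt_path_algebra TYPE('s) G) (cls r) (cls p),
      hplus (leavitt_path_algebra TYPE('s) G) (cls r) (cls q)) \<in> \<rho>"
    "(hmult (leavitt_path_algebra TYPE('s) G) (cls r) (cls p),
      hmult (leavitt_path_algebra TYPE('s) G) (cls r) (cls q)) \<in> \<rho>"
    "(hmult (leavitt_path_algebra TYPE('s) G) (cls p) (cls r),
      hmult (leavitt_path_algebra TYPE('s) G) (cls q) (cls r)) \<in> \<rho>"
    unfolding hemiring_congruence_def by blast+
  then have "(cls (r + p), cls (r + q)) \<in> \<rho>" "(cls (r * p), cls (r * q)) \<in> \<rho>"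
    "(cls (p * r), cls (q * r)) \<in> \<rho>"
    unfolding leavitt_path_algebra_def cls_def
    by (simp_all add: presented_algebra_ops closed assms(2))
  then show "r + p \<approx> r + q" "r * p \<approx> r * q" "p * r \<approx> q * r"
    using closed assms(2) by (simp_all add: related_def free_algebra_plus free_algebra_mult)
qed

lemma related_zero_sum: "(\<And>i. i \<in> I \<Longrightarrow> h i \<approx> 0) \<Longrightarrow> sum h I \<approx> 0"
proof (induction I rule: infinite_finite_induct)
  case (insert i I)
  then have "h i + sum h I \<approx> h i + 0" by (intro related_ops) (auto dest: related_closed)
  then have "h i + sum h I \<approx> 0" using insert.prems[of i] by (auto intro: related_trans)
  with insert show ?case by simp
qed (auto intro: related_if_cong cong_refl free_algebra_zero)

lemma related_zero_context: "p \<approx> 0 \<Longrightarrow> r \<in> A \<Longrightarrow> r' \<in> A \<Longrightarrow> r * p * r' \<approx> 0"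
  using related_ops(2)[of p 0 r] related_ops(3)[of "r * p" 0 r'] by simp

text \<open>
  Only here do the coefficients matter.  Over a field, add \<open>-b u\<close> and divide by \<open>a - b\<close>.  In the Boolean
  case, \<open>a\<close> and \<open>b\<close> are \<open>0\<close> and \<open>1\<close> already.
\<close>

lemma vertex_vanishes:
  assumes S: "is_field_semiring TYPE('s) \<or> is_boolean_semifield TYPE('s)"
    and u: "u \<in> verts G" and "a \<noteq> b"
    and ab: "Poly_Mapping.single (Free_Word [Vertex u]) a \<approx> Poly_Mapping.single (Free_Word [Vertex u]) b"
  shows "mon [Vertex u] \<approx> 0"
  using S
proof
  assume field: "is_field_semiring TYPE('s)"
  let ?m = "\<lambda>c. Poly_Mapping.single (Free_Word [Vertex u]) c :: ('s, ('v, 'e) leavitt_gen) free_elem"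
  have closed: "?m c \<in> A" for c using u by (auto simp: free_algebra_def)
  obtain b' where b': "b + b' = 0" using field unfolding is_field_semiring_def by blast
  have "a + b' \<noteq> 0"
    using b' \<open>a \<noteq> b\<close> by (metis add.assoc add.commute add.right_neutral)
  then obtain d where d: "(a + b') * d = 1" using field unfolding is_field_semiring_def by blast
  have "?m b' + ?m a \<approx> ?m b' + ?m b" by (rule related_ops[OF ab closed])
  then have "?m (a + b') \<approx> 0" using b' by (simp add: single_add[symmetric] add.commute)
  from related_ops(3)[OF this closed[of d]] have "mon [Vertex u, Vertex u] \<approx> 0"
    by (simp add: mult_single plus_free_word_def d)
  then show ?thesis using letter_cong(1)[OF u] cong_sym cong_related_trans by blast
next
  assume boolean: "is_boolean_semifield TYPE('s)"
  then have "a \<in> {0, 1}" "b \<in> {0, 1}" unfolding is_boolean_semifield_def by auto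
  with ab \<open>a \<noteq> b\<close> show ?thesis using related_sym by auto
qed

text \<open>
  The vertices related to zero are hereditary because \<open>r(e) = e* s(e) e\<close>, and saturated because
  \<open>v = \<Sum> e r(e) e*\<close>.  Every monomial ends in a vertex up to congruence, so it vanishes with the vertices.
\<close>

lemma all_related_to_zero:
  assumes ideals: "\<And>H. H \<subseteq> verts G \<Longrightarrow> hereditary G H \<Longrightarrow> saturated G H \<Longrightarrow> H = {} \<or> H = verts G"
    and u: "u \<in> verts G" "mon [Vertex u] \<approx> 0" and x: "x \<in> A"
  shows "x \<approx> 0"
proof -
  define H where "H = {v \<in> verts G. mon [Vertex v] \<approx> 0}"
  have closed: "g \<in> X \<Longrightarrow> mon [g] \<in> A" for g by (rule mon_closed) auto
  have "hereditary G H"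
    unfolding hereditary_def
  proof (intro ballI impI)
    fix e assume e: "e \<in> arcs G" "tail G e \<in> H"
    have "mon [Vertex (head G e)] \<simeq> mon ([Ghost e] @ [Edge e] @ [])"
      using letter_cong(7)[OF e(1)] cong_sym by simp
    also have "\<dots> \<simeq> mon ([Ghost e] @ [Vertex (tail G e), Edge e] @ [])"
      using e by (intro cong_sym[OF mon_context] letter_cong) auto
    also have "\<dots> = mon [Ghost e] * mon [Vertex (tail G e)] * mon [Edge e]"
      by (simp add: mon_append[symmetric])
    also have "\<dots> \<approx> 0" using e closed by (intro related_zero_context) (auto simp: H_def)
    finally show "head G e \<in> H" using e by (simp add: H_def)
  qed
  moreover have "saturated G H"
    unfolding saturated_def
  proof (intro allI impI, elim conjE)
    fix v assume v: "regular_vertex G v" "head G ` out_arcs G v \<subseteq> H"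
    have "mon [Vertex v] \<simeq> (\<Sum>e\<in>out_arcs G v. mon [Edge e, Ghost e])"
      using relation_cong[OF leavitt_relations.regular[OF v(1)]]
      by (simp add: gen_def mult_single plus_free_word_def)
    also have "\<dots> \<approx> 0"
    proof (rule related_zero_sum)
      fix e assume "e \<in> out_arcs G v"
      with v have e: "e \<in> arcs G" "head G e \<in> H" by auto
      have "mon [Edge e, Ghost e] = mon ([] @ [Edge e] @ [Ghost e])" by simp
      also have "\<dots> \<simeq> mon ([] @ [Edge e, Vertex (head G e)] @ [Ghost e])"
        using e by (intro cong_sym[OF mon_context] letter_cong) auto
      also have "\<dots> = mon [Edge e] * mon [Vertex (head G e)] * mon [Ghost e]"
        by (simp add: mon_append[symmetric])
      also have "\<dots> \<approx> 0" using e closed by (intro related_zero_context) (auto simp: H_def)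
      finally show "mon [Edge e, Ghost e] \<approx> 0" .
    qed
    finally show "v \<in> H" using v by (simp add: H_def regular_vertex_def)
  qed
  moreover have "u \<in> H" using u by (simp add: H_def)
  ultimately have H: "H = verts G" using ideals[of H] by (auto simp: H_def)
  have "Poly_Mapping.single w c \<approx> 0" if w: "letters w \<noteq> []" "set (letters w) \<subseteq> X" for w c
  proof -
    from w(1) obtain ws g where wg: "letters w = ws @ [g]" by (metis rev_exhaust)
    with w(2) have g: "g \<in> X" "set ws \<subseteq> X" by auto
    from letter_range[OF g(1)] obtain v where v: "v \<in> verts G" "mon [g] \<simeq> mon [g, Vertex v]" by blast
    \<comment> \<open>The coefficient stays on the left factor, as a hemiring congruence need not respect scalars a priori.\<close>
    have "mon (letters w) \<simeq> mon (letters w) * mon [Vertex v]"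
      using mon_context[OF v(2) g(2), of "[]"] by (simp add: wg mon_append[symmetric])
    from cong_scale[OF this, of c]
    have "Poly_Mapping.single w c \<simeq> Poly_Mapping.single w c * mon [Vertex v]"
      by (simp only: single_eq_scale[of w c] free_scale_conv_mult mult.assoc)
    also have "\<dots> \<approx> Poly_Mapping.single w c * 0"
      using v(1) H w by (intro related_ops) (auto simp: H_def free_algebra_def)
    finally show ?thesis by simp
  qed
  with x have "(\<Sum>w\<in>Poly_Mapping.keys x. Poly_Mapping.single w (Poly_Mapping.lookup x w)) \<approx> 0"
    by (intro related_zero_sum) (auto simp: free_algebra_def)
  then show ?thesis by (simp only: sum_singles)
qed

lemma trivial_congruence:
  assumes S: "is_field_semiring TYPE('s) \<or> is_boolean_semifield TYPE('s)"
    and ideals: "\<And>H. H \<subseteq> verts G \<Longrightarrow> hereditary G H \<Longrightarrow> saturated G H \<Longrightarrow> H = {} \<or> H = verts G"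
    and exits: "\<And>c. cycle c \<Longrightarrow> \<exists>f. is_exit G f c"
  shows "\<rho> = Id_on (cls ` A) \<or> \<rho> = (cls ` A) \<times> (cls ` A)"
proof (cases "\<forall>x y. x \<approx> y \<longrightarrow> x \<simeq> y")
  case True
  have "P = Q" if "(P, Q) \<in> \<rho>" for P Q
  proof -
    from that rho_subset obtain x y where "x \<in> A" "y \<in> A" "P = cls x" "Q = cls y" by blast
    with that True show ?thesis by (simp add: related_def cls_eq_iff)
  qed
  with rho_subset rho_refl have "\<rho> = Id_on (cls ` A)" by (auto simp: Id_on_def; blast)
  then show ?thesis ..
next
  case False
  then obtain x y where xy: "x \<approx> y" "\<not> x \<simeq> y" by blast
  then have closed: "x \<in> A" "y \<in> A" by (auto dest: related_closed)
  obtain n where "reducible n x" "reducible n y"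
    using eventually_reducible[OF closed(1)] eventually_reducible[OF closed(2)]
    by (meson reducible_mono max.cobounded1 max.cobounded2)
  then obtain x' y' where x': "x \<simeq> x'" "normal n x'" and y': "y \<simeq> y'" "normal n y'"
    unfolding reducible_def by blast
  have "x' \<noteq> y'" using x' y' xy(2) by (metis cong_sym cong_trans)
  then obtain w\<^sub>0 where w\<^sub>0: "Poly_Mapping.lookup x' w\<^sub>0 \<noteq> Poly_Mapping.lookup y' w\<^sub>0"
    by (meson poly_mapping_eqI)
  then have "w\<^sub>0 \<in> Poly_Mapping.keys x' \<or> w\<^sub>0 \<in> Poly_Mapping.keys y'" by (auto simp: in_keys_iff)
  then have "normal_word n (letters w\<^sub>0)" using x' y' by (auto simp: normal_def)
  from isolate_coefficient[OF exits, of "{x', y'}" n, OF _ _ _ this] x' y'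
  obtain P Q u where P: "P \<in> A" and Q: "Q \<in> A" and u: "u \<in> verts G"
    and "P * x' * Q \<simeq> Poly_Mapping.single (Free_Word [Vertex u]) (Poly_Mapping.lookup x' w\<^sub>0)"
    and "P * y' * Q \<simeq> Poly_Mapping.single (Free_Word [Vertex u]) (Poly_Mapping.lookup y' w\<^sub>0)"
    by auto
  moreover have "x' \<approx> y'" using x' y' xy(1) by (meson cong_sym related_if_cong related_trans)
  then have "P * x' * Q \<approx> P * y' * Q" using P Q by (intro related_ops)
  ultimately have "Poly_Mapping.single (Free_Word [Vertex u]) (Poly_Mapping.lookup x' w\<^sub>0) \<approx>
      Poly_Mapping.single (Free_Word [Vertex u]) (Poly_Mapping.lookup y' w\<^sub>0)"
    by (meson cong_sym related_if_cong related_trans)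
  from all_related_to_zero[OF ideals u vertex_vanishes[OF S u w\<^sub>0 this]]
  have zero: "x \<approx> 0" if "x \<in> A" for x using that by blast
  have "(cls ` A) \<times> (cls ` A) \<subseteq> \<rho>"
  proof clarify
    fix x y assume "x \<in> A" "y \<in> A"
    then have "x \<approx> y" using related_trans[OF zero related_sym[OF zero]] by blast
    then show "(cls x, cls y) \<in> \<rho>" by (simp add: related_def)
  qed
  with rho_subset have "\<rho> = (cls ` A) \<times> (cls ` A)" by (rule subset_antisym)
  then show ?thesis ..
qed

end

theorem theorem4p5:
  fixes G :: "('v, 'e) pre_digraph"
  assumes "wf_digraph G"
    and "verts G \<noteq> {}"
    and "row_finite G"
  shows "congruence_simple (leavitt_path_algebra TYPE('s::comm_semiring_1) G) \<longleftrightarrow>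
    (is_field_semiring TYPE('s) \<or> is_boolean_semifield TYPE('s)) \<and>
    (\<forall>H. H \<subseteq> verts G \<and> hereditary G H \<and> saturated G H \<longrightarrow> H = {} \<or> H = verts G) \<and>
    (\<forall>p. pre_digraph.cycle G p \<longrightarrow> (\<exists>f. is_exit G f p))"
  (is "?simple \<longleftrightarrow> ?S \<and> ?ideals \<and> ?exits")
proof
  assume simple: ?simple
  show "?S \<and> ?ideals \<and> ?exits"
  proof (intro conjI allI impI; (elim conjE)?)
    show ?S by (rule congruence_simple_coefficients[OF assms simple])
    show "H = {} \<or> H = verts G" if "H \<subseteq> verts G" "hereditary G H" "saturated G H" for H
      by (rule congruence_simple_hereditary_saturated[OF assms simple that])
    show "\<exists>f. is_exit G f p" if "pre_digraph.cycle G p" for p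
      by (rule congruence_simple_cycle_has_exit[OF assms simple that])
  qed
next
  assume conditions: "?S \<and> ?ideals \<and> ?exits"
  show ?simple
    unfolding congruence_simple_def
  proof (intro allI impI)
    fix \<rho> assume "hemiring_congruence (leavitt_path_algebra TYPE('s) G) \<rho>"
    with assms interpret leavitt_congruence G "TYPE('s)" \<rho>
      by (intro leavitt_congruence.intro leavitt_calculus.intro leavitt_calculus_axioms.intro
        leavitt_congruence_axioms.intro)
    show "\<rho> = Id_on (hcarrier (leavitt_path_algebra TYPE('s) G)) \<or>
      \<rho> = hcarrier (leavitt_path_algebra TYPE('s) G) \<times> hcarrier (leavitt_path_algebra TYPE('s) G)"
      unfolding carrier
    proof (rule trivial_congruence)
      show "is_field_semiring TYPE('s) \<or> is_boolean_semifield TYPE('s)"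
        using conditions by (rule conjunct1)
      show "H = {} \<or> H = verts G" if "H \<subseteq> verts G" "hereditary G H" "saturated G H" for H
        using conditions that by simp
      show "\<exists>f. is_exit G f c" if "cycle c" for c
        using conditions that by simp
    qed
  qed
qed

end
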